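(* Let the step sizes be $\alpha_t=a/(t+1)^{\delta}$, $t=0,1,\dots$, with constants $a>0$ and $\delta\in(0.5,1]$, and let $b>0$. Under the network, observability, observation-noise, communication-noise and nonlinearity assumptions listed in the context, for each agent $i=1,\dots,N$ the sequence of iterates $\{\mathbf{x}_i^t\}_{t\ge 0}$ generated by $$\mathbf{x}_{i}^{t+1}=\mathbf{x}_{i}^{t}-\alpha_{t}\left(\frac{b}{a}\sum_{j\in\Omega_{i}}\boldsymbol{\Psi}_{\mathrm c}\left(\mathbf{x}_{i}^{t}-\mathbf{x}_{j}^{t}+\boldsymbol{\xi}_{ij}^t\right)-\mathbf{h}_{i}\Psi_{\mathrm o}\left(z_{i}^{t}-\mathbf{h}_{i}^{\top}\mathbf{x}_{i}^{t}\right)\right)$$ converges almost surely to the true parameter $\boldsymbol{\theta}^{\ast}$.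
   Context: Network and observations. There are $N\ge2$ agents $V=\{1,\dots,N\}$ connected by a static, undirected, simple (no self or multiple links), connected graph $G=(V,E)$. $\Omega_i=\{j:\{i,j\}\in E\}$ is the neighbor set of $i$. The set of arcs $E_d$ contains both $(i,j)$ and $(j,i)$ for every $\{i,j\}\in E$. An unknown $\boldsymbol{\theta}^\ast\in\mathbb{R}^M$ is observed at times $t=0,1,\dots$ through $z_i^t=\mathbf{h}_i^\top\boldsymbol{\theta}^\ast+n_i^t\in\mathbb{R}$, where $\mathbf{h}_i\in\mathbb{R}^M$ is deterministic and nonzero, and the matrix $\sum_{i=1}^N\mathbf{h}_i\mathbf{h}_i^\top$ is invertible. The initial points $\mathbf{x}_i^0\in\mathbb{R}^M$ are arbitrary and deterministic. Observation noise. The random variables $n_i^t$ are mutually independent over all pairs $(i,t)$ and all have the same probability density function (pdf) $p_{\mathrm o}$, where $p_{\mathrm o}(u)=p_{\mathrm o}(-u)$ for all $u$, $p_{\mathrm o}(u)>0$ for $|u|\le r_{\mathrm o}$ for some constant $r_{\mathrm o}>0$, and $\int|u|p_{\mathrm o}(u)\,du<\infty$. Communication noise. For each arc $(i,j)\in E_d$, $\boldsymbol{\xi}_{ij}^t\in\mathbb{R}^M$ is i.i.d. in $t$ and independent across different arcs. Each entry $[\boldsymbol{\xi}_{ij}^t]_\ell$, $\ell=1,\dots,M$, has the same pdf $p_{\mathrm c}$, where $p_{\mathrm c}(u)=p_{\mathrm c}(-u)$ for all $u$, $p_{\mathrm c}(u)>0$ for $|u|\le r_{\mathrm c}$ for some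 constant $r_{\mathrm c}>0$, and $\int|u|p_{\mathrm c}(u)\,du<\infty$. Observation and communication noises at the same time $t$ may be mutually dependent; the joint collection $\big((n_i^t)_i,(\boldsymbol{\xi}_{ij}^t)_{(i,j)\in E_d}\big)$ is i.i.d. in $t$. Nonlinearities. $\Psi_{\mathrm o},\Psi_{\mathrm c}:\mathbb{R}\to\mathbb{R}$, and $\boldsymbol{\Psi}_{\mathrm c}:\mathbb{R}^M\to\mathbb{R}^M$ applies $\Psi_{\mathrm c}$ to each component. Each $\Psi\in\{\Psi_{\mathrm o},\Psi_{\mathrm c}\}$ satisfies: (1) $\Psi$ is odd; (2) $\Psi(u)>0$ for $u>0$; (3) $\Psi$ is monotonically nondecreasing; (4) $\Psi$ is continuous except possibly on a set of Lebesgue measure zero, and is piecewise differentiable; (5) $|\Psi(u)|\le c_1$ for all $u$, for some constant $c_1>0$; (6) $\Psi$ is either discontinuous at zero or strictly increasing on $(-c_2,c_2)$ for some $c_2>0$. *)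

theory Defs
  imports "HOL-Probability.Probability"
begin

definition simple_graph :: "'v set \<Rightarrow> 'v set set \<Rightarrow> bool" where
  "simple_graph V E \<longleftrightarrow> finite V \<and> (\<forall>e\<in>E. e \<subseteq> V \<and> card e = 2)"

definition arcs :: "'v set set \<Rightarrow> ('v \<times> 'v) set" where
  "arcs E = {(i, j). {i, j} \<in> E}"

definition neighbors :: "'v set set \<Rightarrow> 'v \<Rightarrow> 'v set" where
  "neighbors E i = {j. {i, j} \<in> E}"

definition connected_graph :: "'v set \<Rightarrow> 'v set set \<Rightarrow> bool" where
  "connected_graph V E \<longleftrightarrow> (\<forall>i\<in>V. \<forall>j\<in>V. (i, j) \<in> (arcs E)\<^sup>*)"

definition noise_pdf :: "(real \<Rightarrow> real) \<Rightarrow> bool" where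
  "noise_pdf p \<longleftrightarrow>
     p \<in> borel_measurable borel \<and> (\<forall>u. 0 \<le> p u) \<and> (\<integral>\<^sup>+u. ennreal (p u) \<partial>lborel) = 1 \<and>
     (\<forall>u. p u = p (- u)) \<and>
     (\<exists>r>0. \<forall>u. \<bar>u\<bar> \<le> r \<longrightarrow> 0 < p u) \<and>
     integrable lborel (\<lambda>u. \<bar>u\<bar> * p u)"

definition identically_distributed :: "'w measure \<Rightarrow> 'a measure \<Rightarrow> (nat \<Rightarrow> 'w \<Rightarrow> 'a) \<Rightarrow> bool" where
  "identically_distributed P S X \<longleftrightarrow>
     (\<forall>t. X t \<in> measurable P S) \<and> (\<forall>s t. distr P S (X s) = distr P S (X t))"

definition iid :: "'w measure \<Rightarrow> 'a measure \<Rightarrow> (nat \<Rightarrow> 'w \<Rightarrow> 'a) \<Rightarrow> bool" where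
  "iid P S X \<longleftrightarrow>
     prob_space.indep_vars P (\<lambda>_. S) X UNIV \<and> identically_distributed P S X"

text \<open>
  In contrast to the library predicate \<open>piecewise_differentiable_on\<close>, jumps are allowed here: the function need only be
  differentiable off a set of break points that is finite in every bounded interval.
\<close>

definition piecewise_differentiable :: "(real \<Rightarrow> real) \<Rightarrow> bool" where
  "piecewise_differentiable f \<longleftrightarrow>
     (\<exists>S. (\<forall>r. finite (S \<inter> {-r..r})) \<and> (\<forall>u. u \<notin> S \<longrightarrow> f differentiable (at u)))"

definition admissible_nonlinearity :: "(real \<Rightarrow> real) \<Rightarrow> bool" where
  "admissible_nonlinearity \<Psi> \<longleftrightarrow>
     (\<forall>u. \<Psi> (- u) = - \<Psi> u) \<and>
     (\<forall>u>0. 0 < \<Psi> u) \<and>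
     mono \<Psi> \<and>
     {u. \<not> isCont \<Psi> u} \<in> null_sets lebesgue \<and> piecewise_differentiable \<Psi> \<and>
     (\<exists>c\<^sub>1>0. \<forall>u. \<bar>\<Psi> u\<bar> \<le> c\<^sub>1) \<and>
     (\<not> isCont \<Psi> 0 \<or> (\<exists>c\<^sub>2>0. strict_mono_on {-c\<^sub>2<..<c\<^sub>2} \<Psi>))"

definition componentwise :: "(real \<Rightarrow> real) \<Rightarrow> real ^ 'm \<Rightarrow> real ^ 'm" where
  "componentwise \<Psi> v = (\<chi> l. \<Psi> (v $ l))"

end

theory Submission imports Defs begin

text \<open>
  The squared error \<open>U t = (\<Sum>i. (norm (x i t - \<theta>))\<^sup>2)\<close> is a Lyapunov function. Conditionally on the past, a noisy
  nonlinearity \<open>\<Psi> (u + noise)\<close> has mean \<open>\<phi> u\<close>, where \<open>\<phi>\<close> is the average of \<open>\<Psi>\<close> over the noise. Because the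
  noise is symmetric with a density that is positive near \<open>0\<close>, the function \<open>\<phi>\<close> is again odd and nondecreasing,
  and it is strictly positive on the positive half line (\<open>mean_response_pos\<close>).

  One step of the algorithm changes the squared error by \<open>- 2 * \<alpha> t * D t\<close>, plus \<open>\<alpha> t\<close> times
  a martingale difference, plus a term of order \<open>(\<alpha> t)\<^sup>2\<close>. As the graph is undirected, the drift \<open>D t\<close> is a positive combination of terms
  \<open>u * \<phi> u \<ge> 0\<close>, where \<open>u\<close> runs over the coordinates of the disagreements along edges and over the residuals
  \<open>h i \<bullet> (x i t - \<theta>)\<close> (\<open>drift_eq\<close>). If all these \<open>u\<close> are small, connectedness and observability force the
  error to be small (\<open>disagreement_and_residuals_bound_error\<close>); since \<open>u * \<phi> u\<close> increases with \<open>\<bar>u\<bar>\<close>, the drift is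
  therefore bounded away from zero as long as \<open>U t\<close> is (\<open>drift_bounded_below\<close>).

  The remaining argument is of Robbins-Siegmund type (\<open>lyapunov_AE_tendsto_zero\<close>). The nonlinearities
  are bounded, so the variance of the martingale term is at most a constant times \<open>(\<alpha> t)\<^sup>2 * E (U t)\<close>, and
  \<open>E (U t)\<close> stays bounded because the squared step sizes are summable. The martingale part hence has summable
  variances and converges almost surely by Kolmogorov's maximal inequality
  (\<open>martingale_differences_AE_summable\<close>). On almost every path \<open>U t\<close> then converges and
  \<open>\<Sum>t. \<alpha> t * D t\<close> is finite; as the step sizes have infinite sum, the limit must be \<open>0\<close>
  (\<open>recursion_tendsto_zero\<close>).
\<close>


section \<open>Averaging a nonlinearity over symmetric noise\<close>

text \<open>
  For symmetric \<open>p\<close> this is the convolution of \<open>\<Psi>\<close> and \<open>p\<close>.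
\<close>

definition mean_response :: "(real \<Rightarrow> real) \<Rightarrow> (real \<Rightarrow> real) \<Rightarrow> real \<Rightarrow> real" where
  "mean_response p \<Psi> u = (\<integral>v. p v * \<Psi> (u + v) \<partial>lborel)"

lemma noise_pdf_integrable:
  assumes "noise_pdf p" shows "integrable lborel p" "(\<integral>v. p v \<partial>lborel) = 1"
proof -
  have m[measurable]: "p \<in> borel_measurable borel" and n: "\<And>u. 0 \<le> p u"
    and one: "(\<integral>\<^sup>+u. ennreal (p u) \<partial>lborel) = 1"
    using assms by (auto simp: noise_pdf_def)
  show "integrable lborel p"
    by (rule integrableI_nonneg) (auto simp: n one)
  show "(\<integral>v. p v \<partial>lborel) = 1"
    by (subst integral_eq_nn_integral) (auto simp: n one)
qed

lemma mean_response_integrable: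
  assumes "noise_pdf p" "\<Psi> \<in> borel_measurable borel" "\<And>u. \<bar>\<Psi> u\<bar> \<le> c"
  shows "integrable lborel (\<lambda>v. p v * \<Psi> (u + v))"
proof (rule Bochner_Integration.integrable_bound)
  show "integrable lborel (\<lambda>v. c * p v)"
    using noise_pdf_integrable[OF assms(1)] by simp
  have [measurable]: "p \<in> borel_measurable borel" using assms(1) by (simp add: noise_pdf_def)
  show "(\<lambda>v. p v * \<Psi> (u + v)) \<in> borel_measurable lborel"
    using assms(2) by measurable
  have n: "0 \<le> p v" for v using assms(1) by (simp add: noise_pdf_def)
  have "\<bar>\<Psi> (u + v)\<bar> * p v \<le> c * p v" for v
    using assms(3) n by (intro mult_right_mono) auto
  moreover have "0 \<le> c" using assms(3)[of 0] by linarith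
  ultimately show "AE v in lborel. norm (p v * \<Psi> (u + v)) \<le> norm (c * p v)"
    using n by (intro AE_I2) (simp add: abs_mult mult.commute)
qed

lemma mean_response_bounded:
  assumes "noise_pdf p" "\<Psi> \<in> borel_measurable borel" "\<And>u. \<bar>\<Psi> u\<bar> \<le> c"
  shows "\<bar>mean_response p \<Psi> u\<bar> \<le> c"
proof -
  have n: "\<And>v. 0 \<le> p v" using assms(1) by (simp add: noise_pdf_def)
  have "norm (mean_response p \<Psi> u) \<le> (\<integral>v. norm (p v * \<Psi> (u + v)) \<partial>lborel)"
    unfolding mean_response_def by (rule integral_norm_bound)
  also have "\<dots> \<le> (\<integral>v. c * p v \<partial>lborel)"
    using mean_response_integrable[OF assms] noise_pdf_integrable[OF assms(1)] n assms(3)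
    by (intro integral_mono integrable_norm)
       (auto simp: abs_mult mult.commute[of _ "p _"] intro!: mult_left_mono)
  finally show ?thesis using noise_pdf_integrable[OF assms(1)] by simp
qed

lemma mean_response_odd:
  assumes "noise_pdf p" "\<And>u. \<Psi> (- u) = - \<Psi> u"
  shows "mean_response p \<Psi> (- u) = - mean_response p \<Psi> u"
proof -
  have "mean_response p \<Psi> (- u) = (\<integral>v. p (- v) * \<Psi> (- u - v) \<partial>lborel)"
    unfolding mean_response_def
    by (subst lborel_integral_real_affine[where c="-1" and t=0]) auto
  also have "\<dots> = (\<integral>v. - (p v * \<Psi> (u + v)) \<partial>lborel)"
  proof (rule Bochner_Integration.integral_cong[OF refl])
    fix v
    have "p (- v) = p v" using assms(1) by (metis noise_pdf_def)
    moreover have "\<Psi> (- u - v) = - \<Psi> (u + v)" using assms(2)[of "u + v"] by simp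
    ultimately show "p (- v) * \<Psi> (- u - v) = - (p v * \<Psi> (u + v))" by simp
  qed
  finally show ?thesis by (simp add: mean_response_def)
qed

lemma mean_response_mono:
  assumes "noise_pdf p" "mono \<Psi>" "\<And>u. \<bar>\<Psi> u\<bar> \<le> c"
  shows "mono (mean_response p \<Psi>)"
proof (rule monoI)
  fix x y :: real assume "x \<le> y"
  have n: "\<And>v. 0 \<le> p v" using assms(1) by (simp add: noise_pdf_def)
  note int = mean_response_integrable[OF assms(1) borel_measurable_mono[OF assms(2)] assms(3)]
  show "mean_response p \<Psi> x \<le> mean_response p \<Psi> y"
    unfolding mean_response_def using n assms(2) \<open>x \<le> y\<close>
    by (intro integral_mono int mult_left_mono) (auto simp: mono_def)
qed

text \<open>
  The averaged nonlinearity keeps the sign information that \<open>\<Psi>\<close> itself loses under noise: since \<open>p\<close> is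
  symmetric and charges every neighbourhood of \<open>0\<close>, the noise values of modulus below \<open>u\<close> give a strictly
  positive contribution and the others cannot cancel it.
\<close>

lemma mean_response_pos:
  assumes p: "noise_pdf p" and \<Psi>: "admissible_nonlinearity \<Psi>" and u: "0 < u"
  shows "0 < mean_response p \<Psi> u"
proof -
  have n: "\<And>v. 0 \<le> p v" and sym: "\<And>v. p (- v) = p v"
    using p by (auto simp: noise_pdf_def)
  obtain r where r: "r > 0" "\<And>v. \<bar>v\<bar> \<le> r \<Longrightarrow> 0 < p v" using p by (auto simp: noise_pdf_def)
  have odd: "\<And>v. \<Psi> (- v) = - \<Psi> v" and mon: "mono \<Psi>" and pos: "\<And>v. 0 < v \<Longrightarrow> 0 < \<Psi> v"
    using \<Psi> by (auto simp: admissible_nonlinearity_def)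
  obtain c where c: "\<And>v. \<bar>\<Psi> v\<bar> \<le> c" using \<Psi> by (auto simp: admissible_nonlinearity_def)
  note int = mean_response_integrable[OF p borel_measurable_mono[OF mon] c]
  \<comment> \<open>Averaging over \<open>v\<close> and \<open>- v\<close>: for \<open>\<bar>v\<bar> < u\<close> both arguments are positive, and for larger \<open>\<bar>v\<bar>\<close>
    oddness turns the sum into an increment of the nondecreasing \<open>\<Psi>\<close>.\<close>
  let ?f = "\<lambda>v. p v * (\<Psi> (u + v) + \<Psi> (u - v))"
  have eq: "p v * \<Psi> (u - v) = - (p v * \<Psi> (- u + v))" for v
    using odd[of "u - v"] by simp
  have int_f: "integrable lborel ?f"
    using int[of u] int[of "-u"] by (simp add: distrib_left eq del: mult_minus_right)
  have "mean_response p \<Psi> u + mean_response p \<Psi> u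
      = mean_response p \<Psi> u - mean_response p \<Psi> (- u)"
    using mean_response_odd[OF p, of \<Psi> u] odd by simp
  also have "\<dots> = (\<integral>v. ?f v \<partial>lborel)"
    unfolding mean_response_def
    by (subst Bochner_Integration.integral_diff[symmetric, OF int int])
       (simp add: distrib_left eq del: mult_minus_right)
  finally have half: "2 * mean_response p \<Psi> u = (\<integral>v. ?f v \<partial>lborel)" by simp
  have ge: "0 \<le> ?f v" for v
  proof -
    have "\<Psi> (- u + v) \<le> \<Psi> (u + v)" using u by (intro monoD[OF mon]) simp
    then have "0 \<le> \<Psi> (u + v) + \<Psi> (u - v)" using odd[of "u - v"] by simp
    then show ?thesis using n by simp
  qed
  have gt: "0 < ?f v" if "v \<in> {- min r u<..<min r u}" for v
  proof -
    have "\<bar>v\<bar> \<le> r" "0 < u + v" "0 < u - v" using that by auto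
    then show ?thesis by (intro mult_pos_pos[OF r(2) add_pos_pos[OF pos pos]])
  qed
  have "(\<integral>v. ?f v \<partial>lborel) \<noteq> 0"
  proof
    assume "(\<integral>v. ?f v \<partial>lborel) = 0"
    then have "AE v in lborel. ?f v = 0"
      using integral_nonneg_eq_0_iff_AE[OF int_f] ge by auto
    then have "AE v in lborel. v \<notin> {- min r u<..<min r u}"
      by eventually_elim (use gt in fastforce)
    then have "{- min r u<..<min r u} \<in> null_sets lborel"
      by (subst (asm) AE_iff_null_sets[symmetric]) auto
    then have "emeasure lborel {- min r u<..<min r u} = 0" by auto
    then show False using r u by (auto simp: min_def split: if_splits)
  qed
  moreover have "0 \<le> (\<integral>v. ?f v \<partial>lborel)" using ge by (intro integral_nonneg_AE) auto
  ultimately show ?thesis using half by linarith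
qed


section \<open>Series of square integrable martingale differences\<close>

text \<open>
  Orthogonality to all bounded variables of the past is the defining property of the conditional
  expectation \<open>E(d t | F t) = 0\<close>, stated in the form in which it is verified and used below.
\<close>

definition martingale_differences :: "'a measure \<Rightarrow> (nat \<Rightarrow> 'a measure) \<Rightarrow> (nat \<Rightarrow> 'a \<Rightarrow> real) \<Rightarrow> bool" where
  "martingale_differences M F d \<longleftrightarrow>
     (\<forall>t. subalgebra M (F t)) \<and> (\<forall>s t. s \<le> t \<longrightarrow> sets (F s) \<subseteq> sets (F t)) \<and>
     (\<forall>t. d t \<in> borel_measurable (F (Suc t))) \<and>
     (\<forall>t. integrable M (\<lambda>\<omega>. (d t \<omega>)\<^sup>2)) \<and>
     (\<forall>t Y K. Y \<in> borel_measurable (F t) \<longrightarrow> (\<forall>\<omega>\<in>space M. \<bar>Y \<omega>\<bar> \<le> K) \<longrightarrow>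
        (\<integral>\<omega>. Y \<omega> * d t \<omega> \<partial>M) = 0)"

lemma martingale_differences_shift:
  "martingale_differences M F d \<Longrightarrow> martingale_differences M (\<lambda>t. F (m + t)) (\<lambda>t. d (m + t))"
  unfolding martingale_differences_def by simp

lemma martingale_differences_scale:
  assumes "martingale_differences M F d"
  shows "martingale_differences M F (\<lambda>t \<omega>. \<alpha> t * d t \<omega>)"
proof -
  have eq: "(\<integral>\<omega>. Y \<omega> * (\<alpha> t * d t \<omega>) \<partial>M) = \<alpha> t * (\<integral>\<omega>. Y \<omega> * d t \<omega> \<partial>M)" for t Y
    by (subst integral_mult_right_zero[symmetric]) (simp add: mult_ac)
  then show ?thesis
    using assms unfolding martingale_differences_def eq
    by (auto simp: power_mult_distrib intro!: borel_measurable_times)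
qed

text \<open>
  Kolmogorov's inequality. Stopping the partial sums when they first reach modulus \<open>\<epsilon>\<close> preserves the
  martingale property and does not increase the second moment, while the stopped sum at time \<open>n\<close>
  remembers whether \<open>\<epsilon>\<close> was ever reached; Chebyshev's inequality for it is the claim.
\<close>

lemma (in prob_space) martingale_maximal_inequality:
  fixes d :: "nat \<Rightarrow> 'a \<Rightarrow> real"
  assumes mart: "martingale_differences M F d" and \<epsilon>: "0 < \<epsilon>"
  shows "prob {\<omega> \<in> space M. \<exists>k\<le>n. \<epsilon> \<le> \<bar>\<Sum>t<k. d t \<omega>\<bar>}
    \<le> (\<Sum>t<n. expectation (\<lambda>\<omega>. (d t \<omega>)\<^sup>2)) / \<epsilon>\<^sup>2"
proof -
  have F: "\<And>t. subalgebra M (F t)" and F_mono: "\<And>s t. s \<le> t \<Longrightarrow> sets (F s) \<subseteq> sets (F t)"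
    and d_F: "\<And>t. d t \<in> borel_measurable (F (Suc t))"
    and d2: "\<And>t. integrable M (\<lambda>\<omega>. (d t \<omega>)\<^sup>2)"
    and orth: "\<And>t Y K. Y \<in> borel_measurable (F t) \<Longrightarrow> (\<And>\<omega>. \<omega> \<in> space M \<Longrightarrow> \<bar>Y \<omega>\<bar> \<le> K) \<Longrightarrow>
      (\<integral>\<omega>. Y \<omega> * d t \<omega> \<partial>M) = 0"
    using mart unfolding martingale_differences_def by blast+
  have [measurable]: "d t \<in> borel_measurable M" for t using d_F F measurable_from_subalg by blast
  \<comment> \<open>The partial sums, frozen at the first time that they leave \<open>(- \<epsilon>, \<epsilon>)\<close>.\<close>
  define R where "R = rec_nat (\<lambda>\<omega>. 0) (\<lambda>k r \<omega>. r \<omega> + (if \<bar>r \<omega>\<bar> < \<epsilon> then d k \<omega> else 0))"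
  have R_0: "R 0 \<omega> = 0" for \<omega> by (simp add: R_def)
  have R_Suc: "R (Suc k) \<omega> = R k \<omega> + (if \<bar>R k \<omega>\<bar> < \<epsilon> then d k \<omega> else 0)" for k \<omega>
    by (simp add: R_def)
  have R_F: "R k \<in> borel_measurable (F k)" for k
  proof (induction k)
    case 0
    then show ?case by (simp add: R_def)
  next
    case (Suc k)
    have "measurable (F k) borel \<subseteq> measurable (F (Suc k)) borel"
      using F F_mono[of k "Suc k"] unfolding subalgebra_def
      by (intro measurable_mono) auto
    with Suc have [measurable]: "R k \<in> borel_measurable (F (Suc k))" by blast
    note d_F[measurable]
    have "(\<lambda>\<omega>. R k \<omega> + (if \<bar>R k \<omega>\<bar> < \<epsilon> then d k \<omega> else 0)) \<in> borel_measurable (F (Suc k))"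
      by measurable
    then show ?case by (simp add: R_Suc[abs_def])
  qed
  then have [measurable]: "R k \<in> borel_measurable M" for k
    using F measurable_from_subalg by blast
  have R2: "integrable M (\<lambda>\<omega>. (R k \<omega>)\<^sup>2) \<and>
      expectation (\<lambda>\<omega>. (R k \<omega>)\<^sup>2) \<le> (\<Sum>t<k. expectation (\<lambda>\<omega>. (d t \<omega>)\<^sup>2))" for k
  proof (induction k)
    case 0
    then show ?case by (simp add: R_0)
  next
    case (Suc k)
    \<comment> \<open>The cross term of the square: bounded by \<open>\<epsilon>\<close>, so orthogonality applies to it directly.\<close>
    let ?Y = "\<lambda>\<omega>. if \<bar>R k \<omega>\<bar> < \<epsilon> then R k \<omega> else 0"
    let ?D = "\<lambda>\<omega>. if \<bar>R k \<omega>\<bar> < \<epsilon> then (d k \<omega>)\<^sup>2 else 0"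
    have Y_F: "?Y \<in> borel_measurable (F k)" using R_F[of k, measurable] by measurable
    have Y_le: "\<bar>?Y \<omega>\<bar> \<le> \<epsilon>" for \<omega> using \<epsilon> by auto
    have zero: "(\<integral>\<omega>. ?Y \<omega> * d k \<omega> \<partial>M) = 0" by (rule orth[OF Y_F Y_le])
    have iYd: "integrable M (\<lambda>\<omega>. ?Y \<omega> * d k \<omega>)"
    proof (rule Bochner_Integration.integrable_bound)
      show "integrable M (\<lambda>\<omega>. \<epsilon>\<^sup>2 + (d k \<omega>)\<^sup>2)" using d2 by simp
      show "AE \<omega> in M. norm (?Y \<omega> * d k \<omega>) \<le> norm (\<epsilon>\<^sup>2 + (d k \<omega>)\<^sup>2)"
      proof (rule AE_I2)
        fix \<omega>
        have "\<bar>?Y \<omega>\<bar> * \<bar>d k \<omega>\<bar> \<le> \<epsilon> * \<bar>d k \<omega>\<bar>" by (rule mult_right_mono[OF Y_le]) simp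
        also have "\<dots> \<le> \<epsilon>\<^sup>2 + \<bar>d k \<omega>\<bar>\<^sup>2"
          using sum_squares_bound[of \<epsilon> "\<bar>d k \<omega>\<bar>"] \<epsilon> mult_nonneg_nonneg[of \<epsilon> "\<bar>d k \<omega>\<bar>"] by linarith
        finally show "norm (?Y \<omega> * d k \<omega>) \<le> norm (\<epsilon>\<^sup>2 + (d k \<omega>)\<^sup>2)"
          by (simp add: abs_mult)
      qed
    qed measurable
    have iD: "integrable M ?D"
    proof (rule Bochner_Integration.integrable_bound[OF d2[of k]])
      show "?D \<in> borel_measurable M" by measurable
    qed auto
    have "expectation ?D \<le> expectation (\<lambda>\<omega>. (d k \<omega>)\<^sup>2)"
      by (rule integral_mono[OF iD d2]) auto
    moreover have "(\<lambda>\<omega>. (R (Suc k) \<omega>)\<^sup>2) = (\<lambda>\<omega>. ((R k \<omega>)\<^sup>2 + 2 * (?Y \<omega> * d k \<omega>)) + ?D \<omega>)"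
      by (auto simp: R_Suc power2_sum fun_eq_iff)
    ultimately show ?case using Suc iYd iD zero by simp
  qed
  have frozen: "\<epsilon> \<le> \<bar>R n \<omega>\<bar>" if "k \<le> n" "\<epsilon> \<le> \<bar>\<Sum>t<k. d t \<omega>\<bar>" for k \<omega>
  proof -
    have "\<epsilon> \<le> \<bar>R m \<omega>\<bar> \<or> R m \<omega> = (\<Sum>t<m. d t \<omega>)" for m
      by (induction m) (auto simp: R_0 R_Suc)
    with that(2) have "\<epsilon> \<le> \<bar>R k \<omega>\<bar>" by metis
    with \<open>k \<le> n\<close> show ?thesis
      by (induction rule: dec_induct) (auto simp: R_Suc)
  qed
  have "prob {\<omega> \<in> space M. \<exists>k\<le>n. \<epsilon> \<le> \<bar>\<Sum>t<k. d t \<omega>\<bar>} \<le> prob {\<omega> \<in> space M. \<epsilon> \<le> \<bar>R n \<omega>\<bar>}"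
    by (intro finite_measure_mono) (auto intro: frozen)
  also have "\<dots> \<le> expectation (\<lambda>\<omega>. (R n \<omega>)\<^sup>2) / \<epsilon>\<^sup>2"
    using second_moment_method[of "R n"  \<epsilon>] R2[of n] \<epsilon> by simp
  also have "\<dots> \<le> (\<Sum>t<n. expectation (\<lambda>\<omega>. (d t \<omega>)\<^sup>2)) / \<epsilon>\<^sup>2"
    using R2[of n] by (intro divide_right_mono) auto
  finally show ?thesis .
qed

lemma (in prob_space) martingale_maximal_inequality_series:
  fixes d :: "nat \<Rightarrow> 'a \<Rightarrow> real"
  assumes mart: "martingale_differences M F d" and \<epsilon>: "0 < \<epsilon>"
    and sm: "summable (\<lambda>t. expectation (\<lambda>\<omega>. (d t \<omega>)\<^sup>2))"
  shows "prob {\<omega> \<in> space M. \<exists>k. \<epsilon> \<le> \<bar>\<Sum>t<k. d t \<omega>\<bar>}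
    \<le> (\<Sum>t. expectation (\<lambda>\<omega>. (d t \<omega>)\<^sup>2)) / \<epsilon>\<^sup>2"
proof -
  have [measurable]: "d t \<in> borel_measurable M" for t
    using mart measurable_from_subalg unfolding martingale_differences_def by blast
  define A where "A = (\<lambda>n. {\<omega> \<in> space M. \<exists>k\<le>n. \<epsilon> \<le> \<bar>\<Sum>t<k. d t \<omega>\<bar>})"
  have [measurable]: "A n \<in> sets M" for n unfolding A_def by measurable
  have "(\<lambda>n. prob (A n)) \<longlonglongrightarrow> prob (\<Union>n. A n)"
    by (rule finite_Lim_measure_incseq) (auto simp: incseq_def A_def intro: order_trans)
  moreover have "(\<Union>n. A n) = {\<omega> \<in> space M. \<exists>k. \<epsilon> \<le> \<bar>\<Sum>t<k. d t \<omega>\<bar>}"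
    unfolding A_def by auto
  moreover have "prob (A n) \<le> (\<Sum>t. expectation (\<lambda>\<omega>. (d t \<omega>)\<^sup>2)) / \<epsilon>\<^sup>2" for n
  proof -
    have "prob (A n) \<le> (\<Sum>t<n. expectation (\<lambda>\<omega>. (d t \<omega>)\<^sup>2)) / \<epsilon>\<^sup>2"
      unfolding A_def by (rule martingale_maximal_inequality[OF mart \<epsilon>])
    also have "\<dots> \<le> (\<Sum>t. expectation (\<lambda>\<omega>. (d t \<omega>)\<^sup>2)) / \<epsilon>\<^sup>2"
      by (intro divide_right_mono sum_le_suminf sm) auto
    finally show ?thesis .
  qed
  ultimately show ?thesis by (auto intro!: LIMSEQ_le_const2)
qed

text \<open>
  The maximal inequality applied to the series started at \<open>m\<close> bounds the oscillation of the partial sums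
  after \<open>m\<close> in probability; as \<open>m\<close> grows the bound vanishes, so almost all paths are Cauchy.
\<close>

theorem (in prob_space) martingale_differences_AE_summable:
  fixes d :: "nat \<Rightarrow> 'a \<Rightarrow> real"
  assumes mart: "martingale_differences M F d"
    and sm: "summable (\<lambda>t. expectation (\<lambda>\<omega>. (d t \<omega>)\<^sup>2))"
  shows "AE \<omega> in M. summable (\<lambda>t. d t \<omega>)"
proof -
  have [measurable]: "d t \<in> borel_measurable M" for t
    using mart measurable_from_subalg unfolding martingale_differences_def by blast
  let ?tail = "\<lambda>m. \<Sum>t. expectation (\<lambda>\<omega>. (d (m + t) \<omega>)\<^sup>2)"
  have tail: "?tail \<longlonglongrightarrow> 0"
    using suminf_exist_split2[OF sm] by (simp add: add.commute)
  have osc: "AE \<omega> in M. \<exists>m. \<forall>k. \<bar>\<Sum>t<k. d (m + t) \<omega>\<bar> < \<epsilon>" if \<epsilon>: "0 < \<epsilon>" for \<epsilon> :: real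
  proof -
    \<comment> \<open>\<open>?N\<close> lies in every \<open>?B m\<close>, whose probability is bounded by a tail of the variance series.\<close>
    let ?B = "\<lambda>m. {\<omega> \<in> space M. \<exists>k. \<epsilon> \<le> \<bar>\<Sum>t<k. d (m + t) \<omega>\<bar>}"
    let ?N = "{\<omega> \<in> space M. \<forall>m. \<exists>k. \<epsilon> \<le> \<bar>\<Sum>t<k. d (m + t) \<omega>\<bar>}"
    have "prob ?N \<le> ?tail m / \<epsilon>\<^sup>2" for m
    proof -
      have "prob ?N \<le> prob (?B m)" by (intro finite_measure_mono) auto
      also have "\<dots> \<le> ?tail m / \<epsilon>\<^sup>2"
        using summable_ignore_initial_segment[OF sm, of m]
        by (intro martingale_maximal_inequality_series[OF martingale_differences_shift[OF mart] \<epsilon>])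
           (simp add: add.commute)
      finally show ?thesis .
    qed
    moreover have "(\<lambda>m. ?tail m / \<epsilon>\<^sup>2) \<longlonglongrightarrow> 0"
      using tendsto_divide[OF tail tendsto_const[of "\<epsilon>\<^sup>2"]] \<epsilon> by simp
    ultimately have "prob ?N \<le> 0" by (auto intro!: LIMSEQ_le_const)
    then have "prob ?N = 0" by (simp add: measure_le_0_iff)
    moreover have "?N \<in> sets M" by measurable
    ultimately have "?N \<in> null_sets M" by (simp add: emeasure_eq_measure null_sets_def)
    then have "AE \<omega> in M. \<omega> \<notin> ?N" by (rule AE_not_in)
    then show ?thesis using AE_space by eventually_elim (auto simp: not_le)
  qed
  have "AE \<omega> in M. \<forall>q. \<exists>m. \<forall>k. \<bar>\<Sum>t<k. d (m + t) \<omega>\<bar> < inverse (real (Suc q))"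
    unfolding AE_all_countable by (auto intro: osc)
  then show ?thesis
  proof eventually_elim
    fix \<omega> assume small: "\<forall>q. \<exists>m. \<forall>k. \<bar>\<Sum>t<k. d (m + t) \<omega>\<bar> < inverse (real (Suc q))"
    have "Cauchy (\<lambda>n. \<Sum>t<n. d t \<omega>)"
    proof (rule metric_CauchyI)
      fix e :: real assume "0 < e"
      obtain q where q: "inverse (real (Suc q)) < e / 2"
        using reals_Archimedean[of "e / 2"] \<open>0 < e\<close> by auto
      obtain m where m: "\<And>k. \<bar>\<Sum>t<k. d (m + t) \<omega>\<bar> < inverse (real (Suc q))" using small by blast
      have near: "\<bar>(\<Sum>t<n. d t \<omega>) - (\<Sum>t<m. d t \<omega>)\<bar> < e / 2" if "m \<le> n" for n
      proof -
        have "(\<Sum>t<n. d t \<omega>) - (\<Sum>t<m. d t \<omega>) = (\<Sum>t<n - m. d (m + t) \<omega>)"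
          using sum.nat_group that sum_diff_nat_ivl[of 0 m n "\<lambda>t. d t \<omega>"]
            sum.shift_bounds_nat_ivl[of "\<lambda>t. d t \<omega>" 0 m "n - m"]
          by (simp add: atLeast0LessThan add.commute)
        then show ?thesis using m[of "n - m"] q by simp
      qed
      have "dist (\<Sum>t<n. d t \<omega>) (\<Sum>t<n'. d t \<omega>) < e" if "m \<le> n" "m \<le> n'" for n n'
        using near[OF that(1)] near[OF that(2)] unfolding dist_real_def by linarith
      then show "\<exists>M. \<forall>m\<ge>M. \<forall>n\<ge>M. dist (\<Sum>t<m. d t \<omega>) (\<Sum>t<n. d t \<omega>) < e" by blast
    qed
    then show "summable (\<lambda>t. d t \<omega>)"
      by (simp add: summable_iff_convergent Cauchy_convergent)
  qed
qed


section \<open>Stochastic Lyapunov recursions\<close>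

text \<open>
  Since \<open>V\<close> is nonnegative and the perturbations sum up, the total decrease \<open>\<Sum>t. \<alpha> t * D t\<close> is finite, and
  hence \<open>V\<close> converges. A positive limit would keep \<open>D\<close> away from zero, which is incompatible with
  infinite total step size.
\<close>

lemma recursion_tendsto_zero:
  fixes V D \<alpha> m :: "nat \<Rightarrow> real"
  assumes V: "\<And>t. 0 \<le> V t" and D: "\<And>t. 0 \<le> D t" and \<alpha>: "\<And>t. 0 \<le> \<alpha> t" "\<not> summable \<alpha>"
    and rec: "\<And>t. V (Suc t) = V t - \<alpha> t * D t + m t" and m: "summable m"
    and drift: "\<And>\<epsilon>. 0 < \<epsilon> \<Longrightarrow> \<exists>\<eta>>0. \<forall>t. \<epsilon> \<le> V t \<longrightarrow> \<eta> \<le> D t"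
  shows "V \<longlonglongrightarrow> 0"
proof -
  have V_eq: "V t = V 0 - (\<Sum>s<t. \<alpha> s * D s) + (\<Sum>s<t. m s)" for t
    by (induction t) (auto simp: rec)
  have "Bseq (\<lambda>t. \<Sum>s<t. m s)"
    using m by (intro convergent_imp_Bseq) (simp add: summable_iff_convergent)
  then obtain B where B: "\<And>t. \<bar>\<Sum>s<t. m s\<bar> \<le> B" by (auto simp: Bseq_def)
  have sD: "summable (\<lambda>t. \<alpha> t * D t)"
  proof (rule bounded_imp_summable)
    fix t
    have "(\<Sum>s<Suc t. \<alpha> s * D s) \<le> V 0 + B"
      using V_eq[of "Suc t"] V[of "Suc t"] B[of "Suc t"] by linarith
    then show "(\<Sum>s\<le>t. \<alpha> s * D s) \<le> V 0 + B" by (simp only: lessThan_Suc_atMost)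
  qed (simp add: \<alpha> D)
  have "V \<longlonglongrightarrow> V 0 - (\<Sum>s. \<alpha> s * D s) + (\<Sum>s. m s)"
    by (subst V_eq[abs_def]) (intro tendsto_intros summable_LIMSEQ sD m)
  then obtain L where L: "V \<longlonglongrightarrow> L" by blast
  have "L = 0"
  proof (rule ccontr)
    assume "L \<noteq> 0"
    then have "0 < L" using LIMSEQ_le_const[OF L, of 0] V by force
    obtain \<eta> where \<eta>: "0 < \<eta>" "\<And>t. L / 2 \<le> V t \<Longrightarrow> \<eta> \<le> D t" using drift[of "L / 2"] \<open>0 < L\<close> by auto
    have "\<forall>\<^sub>F t in sequentially. L / 2 < V t" using L \<open>0 < L\<close> by (intro order_tendstoD) auto
    then have "\<forall>\<^sub>F t in sequentially. norm (\<alpha> t) \<le> \<alpha> t * D t / \<eta>"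
    proof eventually_elim
      fix t assume "L / 2 < V t"
      then have "\<alpha> t * \<eta> \<le> \<alpha> t * D t" using \<alpha>(1) \<eta>(2)[of t] by (intro mult_left_mono) auto
      then show "norm (\<alpha> t) \<le> \<alpha> t * D t / \<eta>" using \<eta>(1) \<alpha>(1)[of t] by (simp add: field_simps)
    qed
    then have "summable \<alpha>" by (rule summable_comparison_test_ev) (intro summable_divide sD)
    then show False using \<alpha>(2) by simp
  qed
  with L show ?thesis by simp
qed

text \<open>
  A stochastic Lyapunov criterion in the manner of Robbins and Siegmund. Taking expectations in the recursion bounds
  \<open>E (U t)\<close> uniformly in \<open>t\<close>. As the variance of the fluctuation \<open>d t\<close> is controlled by \<open>E (U t)\<close>, the
  series \<open>\<Sum>t. \<alpha> t * d t\<close> has summable variances and converges almost surely; what is left on each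
  path is the deterministic recursion of the preceding lemma.
\<close>

theorem (in prob_space) lyapunov_AE_tendsto_zero:
  fixes U D d r :: "nat \<Rightarrow> 'a \<Rightarrow> real"
  assumes d: "martingale_differences M F d"
    and rec: "\<And>t \<omega>. \<omega> \<in> space M \<Longrightarrow>
      U (Suc t) \<omega> = U t \<omega> - \<alpha> t * D t \<omega> + \<alpha> t * d t \<omega> + (\<alpha> t)\<^sup>2 * r t \<omega>"
    and U: "\<And>t \<omega>. 0 \<le> U t \<omega>" "\<And>t. integrable M (U t)"
    and D: "\<And>t \<omega>. 0 \<le> D t \<omega>"
    and r: "\<And>t \<omega>. 0 \<le> r t \<omega>" "\<And>t \<omega>. r t \<omega> \<le> C"
    and d2: "\<And>t. expectation (\<lambda>\<omega>. (d t \<omega>)\<^sup>2) \<le> C' * expectation (U t)" and C': "0 \<le> C'"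
    and \<alpha>: "\<And>t. 0 \<le> \<alpha> t" "\<not> summable \<alpha>" "summable (\<lambda>t. (\<alpha> t)\<^sup>2)"
    and drift: "\<And>\<epsilon>. 0 < \<epsilon> \<Longrightarrow> \<exists>\<eta>>0. \<forall>t \<omega>. \<epsilon> \<le> U t \<omega> \<longrightarrow> \<eta> \<le> D t \<omega>"
  shows "AE \<omega> in M. (\<lambda>t. U t \<omega>) \<longlonglongrightarrow> 0"
proof -
  have int_d: "integrable M (d t)" and zero_d: "expectation (d t) = 0" for t
  proof -
    have "d t \<in> borel_measurable M" "integrable M (\<lambda>\<omega>. (d t \<omega>)\<^sup>2)"
      using d measurable_from_subalg unfolding martingale_differences_def by blast+
    then show "integrable M (d t)" by (rule square_integrable_imp_integrable)
    have "(\<integral>\<omega>. 1 * d t \<omega> \<partial>M) = 0"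
      using d unfolding martingale_differences_def
      by (elim conjE allE[of _ t] allE[of _ "\<lambda>_. 1"] allE[of _ 1]) auto
    then show "expectation (d t) = 0" by simp
  qed
  have C: "0 \<le> C" using r[of 0 undefined] by linarith
  \<comment> \<open>Dropping the nonnegative drift leaves a mean increase of at most \<open>C * (\<alpha> t)\<^sup>2\<close> per step.\<close>
  have EU: "expectation (U t) \<le> expectation (U 0) + C * (\<Sum>s<t. (\<alpha> s)\<^sup>2)" for t
  proof (induction t)
    case (Suc t)
    have "expectation (U (Suc t)) \<le> expectation (\<lambda>\<omega>. U t \<omega> + \<alpha> t * d t \<omega> + (\<alpha> t)\<^sup>2 * C)"
    proof (rule integral_mono)
      fix \<omega> assume "\<omega> \<in> space M"
      have "0 \<le> \<alpha> t * D t \<omega>" "(\<alpha> t)\<^sup>2 * r t \<omega> \<le> (\<alpha> t)\<^sup>2 * C"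
        using \<alpha>(1) D r(2) by (auto intro: mult_left_mono)
      then show "U (Suc t) \<omega> \<le> U t \<omega> + \<alpha> t * d t \<omega> + (\<alpha> t)\<^sup>2 * C"
        using rec[OF \<open>\<omega> \<in> space M\<close>, of t] by linarith
    qed (use U(2) int_d in auto)
    also have "\<dots> = expectation (U t) + (\<alpha> t)\<^sup>2 * C"
      using U(2) int_d zero_d prob_space by simp
    finally show ?case using Suc by (simp add: algebra_simps)
  qed simp
  define K where "K = expectation (U 0) + C * (\<Sum>s. (\<alpha> s)\<^sup>2)"
  have EU_le: "expectation (U t) \<le> K" for t
  proof -
    have "C * (\<Sum>s<t. (\<alpha> s)\<^sup>2) \<le> C * (\<Sum>s. (\<alpha> s)\<^sup>2)"
      using C by (intro mult_left_mono sum_le_suminf \<alpha>(3)) auto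
    then show ?thesis using EU[of t] unfolding K_def by linarith
  qed
  have "summable (\<lambda>t. expectation (\<lambda>\<omega>. (\<alpha> t * d t \<omega>)\<^sup>2))"
  proof (rule summable_comparison_test')
    show "summable (\<lambda>t. (\<alpha> t)\<^sup>2 * (C' * K))" by (intro summable_mult2 \<alpha>(3))
    fix t
    have "expectation (\<lambda>\<omega>. (\<alpha> t * d t \<omega>)\<^sup>2) = (\<alpha> t)\<^sup>2 * expectation (\<lambda>\<omega>. (d t \<omega>)\<^sup>2)"
      by (simp add: power_mult_distrib)
    also have "\<dots> \<le> (\<alpha> t)\<^sup>2 * (C' * K)"
      using d2[of t] EU_le[of t] C' by (intro mult_left_mono) (auto intro: order_trans mult_left_mono)
    finally show "norm (expectation (\<lambda>\<omega>. (\<alpha> t * d t \<omega>)\<^sup>2)) \<le> (\<alpha> t)\<^sup>2 * (C' * K)" by simp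
  qed
  from martingale_differences_AE_summable[OF martingale_differences_scale[OF d] this]
  have "AE \<omega> in M. summable (\<lambda>t. \<alpha> t * d t \<omega>)" .
  then show ?thesis
    using AE_space
  proof eventually_elim
    fix \<omega> assume \<omega>: "summable (\<lambda>t. \<alpha> t * d t \<omega>)" "\<omega> \<in> space M"
    have "summable (\<lambda>t. (\<alpha> t)\<^sup>2 * r t \<omega>)"
    proof (rule summable_comparison_test')
      show "summable (\<lambda>t. (\<alpha> t)\<^sup>2 * C)" by (intro summable_mult2 \<alpha>(3))
      show "norm ((\<alpha> t)\<^sup>2 * r t \<omega>) \<le> (\<alpha> t)\<^sup>2 * C" for t
        using r by (simp add: abs_mult mult_left_mono)
    qed
    with \<omega>(1) have "summable (\<lambda>t. \<alpha> t * d t \<omega> + (\<alpha> t)\<^sup>2 * r t \<omega>)" by (rule summable_add)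
    then show "(\<lambda>t. U t \<omega>) \<longlonglongrightarrow> 0"
    proof (rule recursion_tendsto_zero[rotated 5, where \<alpha>=\<alpha> and D="\<lambda>t. D t \<omega>"])
      show "\<exists>\<eta>>0. \<forall>t. \<epsilon> \<le> U t \<omega> \<longrightarrow> \<eta> \<le> D t \<omega>" if "0 < \<epsilon>" for \<epsilon>
        using drift[OF that] by blast
    qed (use U D \<alpha> rec[OF \<omega>(2)] in auto)
  qed
qed

lemma step_sizes:
  fixes a \<delta> :: real
  assumes "a > 0" "1/2 < \<delta>" "\<delta> \<le> 1" "\<And>t. \<alpha> t = a / (real t + 1) powr \<delta>"
  shows "\<not> summable \<alpha>" "summable (\<lambda>t. (\<alpha> t)\<^sup>2)"
proof -
  have \<alpha>: "\<alpha> = (\<lambda>t. a * real (Suc t) powr (- \<delta>))"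
    by (rule ext) (simp add: assms(4) powr_minus_divide add.commute)
  have s: "summable (\<lambda>t. real (Suc t) powr s) \<longleftrightarrow> s < -1" for s
    by (subst summable_Suc_iff) (rule summable_real_powr_iff)
  show "\<not> summable \<alpha>"
    unfolding \<alpha> using s[of "- \<delta>"] assms(1,3) by (simp add: summable_cmult_iff)
  have "(\<lambda>t. (\<alpha> t)\<^sup>2) = (\<lambda>t. a\<^sup>2 * real (Suc t) powr (- 2 * \<delta>))"
    by (simp add: \<alpha> power_mult_distrib power2_eq_square[of "_ powr _"] powr_add[symmetric] fun_eq_iff)
  then show "summable (\<lambda>t. (\<alpha> t)\<^sup>2)"
    using s[of "- 2 * \<delta>"] assms(2) by (simp add: summable_mult)
qed


section \<open>Independence of the past and the present noise\<close>

text \<open>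
  Generated by the joint map into the product space, so that independence of disjoint blocks of coordinates
  carries over directly.
\<close>

definition past :: "'a measure \<Rightarrow> 'b measure \<Rightarrow> (nat \<Rightarrow> 'a \<Rightarrow> 'b) \<Rightarrow> nat \<Rightarrow> 'a measure" where
  "past M S W t = vimage_algebra (space M) (\<lambda>\<omega>. \<lambda>s\<in>{..<t}. W s \<omega>) (\<Pi>\<^sub>M s\<in>{..<t}. S)"

lemma history_measurable:
  assumes "\<And>s. W s \<in> measurable M S"
  shows "(\<lambda>\<omega>. \<lambda>s\<in>I. W s \<omega>) \<in> measurable M (\<Pi>\<^sub>M s\<in>I. S)"
    and "(\<lambda>\<omega>. \<lambda>s\<in>I. W s \<omega>) \<in> space M \<rightarrow> space (\<Pi>\<^sub>M s\<in>I. S)"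
proof -
  show "(\<lambda>\<omega>. \<lambda>s\<in>I. W s \<omega>) \<in> measurable M (\<Pi>\<^sub>M s\<in>I. S)"
    using assms by (rule measurable_restrict)
  then show "(\<lambda>\<omega>. \<lambda>s\<in>I. W s \<omega>) \<in> space M \<rightarrow> space (\<Pi>\<^sub>M s\<in>I. S)"
    by (simp add: measurable_def)
qed

lemma measurable_past:
  assumes "\<And>s. W s \<in> measurable M S" "s < t"
  shows "W s \<in> measurable (past M S W t) S"
proof -
  have "(\<lambda>\<omega>. \<lambda>s\<in>{..<t}. W s \<omega>) \<in> measurable (past M S W t) (\<Pi>\<^sub>M s\<in>{..<t}. S)"
    unfolding past_def by (intro measurable_vimage_algebra1 history_measurable assms(1))
  from measurable_compose[OF this measurable_component_singleton[of s]] show ?thesis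
    using assms(2) by simp
qed

lemma subalgebra_past:
  assumes "\<And>s. W s \<in> measurable M S"
  shows "subalgebra M (past M S W t)"
  unfolding subalgebra_def past_def
  using measurable_sets[OF history_measurable(1)[of W M S "{..<t}", OF assms]]
  by (auto simp: sets_vimage_algebra2[OF history_measurable(2)[OF assms]])

lemma past_mono:
  assumes "\<And>s. W s \<in> measurable M S" "s \<le> t"
  shows "sets (past M S W s) \<subseteq> sets (past M S W t)"
proof
  fix A assume "A \<in> sets (past M S W s)"
  then obtain B where B: "B \<in> sets (\<Pi>\<^sub>M r\<in>{..<s}. S)"
    and A: "A = (\<lambda>\<omega>. \<lambda>r\<in>{..<s}. W r \<omega>) -` B \<inter> space M"
    unfolding past_def by (auto simp: sets_vimage_algebra2[OF history_measurable(2)[OF assms(1)]])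
  have "(\<lambda>\<omega>. \<lambda>r\<in>{..<s}. W r \<omega>) \<in> measurable (past M S W t) (\<Pi>\<^sub>M r\<in>{..<s}. S)"
    using assms by (intro measurable_restrict measurable_past) auto
  from measurable_sets[OF this B] show "A \<in> sets (past M S W t)"
    unfolding A by (simp add: past_def)
qed

text \<open>
  Functions of \<open>W t\<close> depend on a coordinate that is not among those that generate \<open>past M S W t\<close>.
\<close>

lemma (in prob_space) past_indep:
  assumes W: "indep_vars (\<lambda>_. S) W UNIV" and g: "g \<in> measurable S borel"
  shows "indep_set (sets (past M S W t)) (sets (vimage_algebra (space M) (\<lambda>\<omega>. g (W t \<omega>)) borel))"
proof -
  have rv: "W s \<in> measurable M S" for s using W by (auto simp: indep_vars_def)
  let ?H = "\<lambda>\<omega>. \<lambda>s\<in>{..<t}. W s \<omega>" and ?G = "\<lambda>\<omega>. \<lambda>s\<in>{t}. W s \<omega>"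
  have ind: "indep_set (sigma_sets (space M) {?H -` A \<inter> space M |A. A \<in> sets (\<Pi>\<^sub>M s\<in>{..<t}. S)})
      (sigma_sets (space M) {?G -` A \<inter> space M |A. A \<in> sets (\<Pi>\<^sub>M s\<in>{t}. S)})"
    using indep_var_restrict[OF W, of "{..<t}" "{t}"] by (simp add: indep_var_eq)
  have gW: "(\<lambda>\<omega>. g (W t \<omega>)) = (\<lambda>x. g (x t)) \<circ> ?G" by auto
  have gt: "(\<lambda>x. g (x t)) \<in> measurable (\<Pi>\<^sub>M s\<in>{t}. S) borel" using g by measurable
  have "sets (vimage_algebra (space M) (\<lambda>\<omega>. g (W t \<omega>)) borel)
      \<subseteq> sigma_sets (space M) {?G -` A \<inter> space M |A. A \<in> sets (\<Pi>\<^sub>M s\<in>{t}. S)}"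
  proof
    fix A assume "A \<in> sets (vimage_algebra (space M) (\<lambda>\<omega>. g (W t \<omega>)) borel)"
    then obtain B where B: "B \<in> sets borel" and A: "A = (\<lambda>\<omega>. g (W t \<omega>)) -` B \<inter> space M"
      by (auto simp: sets_vimage_algebra2)
    have "(\<lambda>x. g (x t)) -` B \<inter> space (\<Pi>\<^sub>M s\<in>{t}. S) \<in> sets (\<Pi>\<^sub>M s\<in>{t}. S)"
      using measurable_sets[OF gt B] .
    moreover have "A = ?G -` ((\<lambda>x. g (x t)) -` B \<inter> space (\<Pi>\<^sub>M s\<in>{t}. S)) \<inter> space M"
      unfolding A using history_measurable(2)[of W M S "{t}", OF rv] by auto
    ultimately show "A \<in> sigma_sets (space M) {?G -` A \<inter> space M |A. A \<in> sets (\<Pi>\<^sub>M s\<in>{t}. S)}"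
      by (intro sigma_sets.Basic) blast
  qed
  then show ?thesis
    using ind unfolding indep_sets2_eq past_def sets_vimage_algebra by blast
qed

text \<open>
  Fresh noise \<open>\<zeta>\<close> is independent of \<open>F\<close>, so conditionally on \<open>F\<close> the variable \<open>X\<close> acts as a constant and
  \<open>\<Psi> (X + \<zeta>)\<close> has mean \<open>mean_response p \<Psi> X\<close>.
\<close>

lemma (in prob_space) fluctuation_orthogonal:
  fixes X Y \<zeta> :: "'a \<Rightarrow> real"
  assumes F: "subalgebra M F" and X: "X \<in> borel_measurable F" and Y: "Y \<in> borel_measurable F"
    and bY: "\<And>\<omega>. \<omega> \<in> space M \<Longrightarrow> \<bar>Y \<omega>\<bar> \<le> K"
    and \<zeta>: "distributed M lborel \<zeta> (\<lambda>u. ennreal (p u))" and p: "noise_pdf p"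
    and ind: "indep_set (sets F) (sets (vimage_algebra (space M) \<zeta> borel))"
    and \<Psi>: "mono \<Psi>" "\<And>u. \<bar>\<Psi> u\<bar> \<le> c"
  shows "has_bochner_integral M (\<lambda>\<omega>. Y \<omega> * (mean_response p \<Psi> (X \<omega>) - \<Psi> (X \<omega> + \<zeta> \<omega>))) 0"
proof -
  define \<phi> where "\<phi> = mean_response p \<Psi>"
  have mono_\<phi>: "mono \<phi>" unfolding \<phi>_def by (rule mean_response_mono[OF p \<Psi>])
  have [measurable]: "\<Psi> \<in> borel_measurable borel" "\<phi> \<in> borel_measurable borel"
    by (auto intro: borel_measurable_mono \<Psi> mono_\<phi>)
  have \<phi>_le: "\<bar>\<phi> u\<bar> \<le> c" for u unfolding \<phi>_def by (rule mean_response_bounded[OF p _ \<Psi>(2)]) simp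
  have [measurable]: "X \<in> borel_measurable M" "Y \<in> borel_measurable M"
    using X Y F measurable_from_subalg by blast+
  have [measurable]: "\<zeta> \<in> borel_measurable M"
    using distributed_measurable[OF \<zeta>] by simp
  let ?Z = "\<lambda>\<omega>. (X \<omega>, Y \<omega>)"
  have Z_F: "?Z \<in> measurable F (borel \<Otimes>\<^sub>M borel)" using X Y by measurable
  interpret Z: prob_space "distr M (borel \<Otimes>\<^sub>M borel) ?Z" by (rule prob_space_distr) measurable
  interpret Ze: prob_space "distr M borel \<zeta>" by (rule prob_space_distr) measurable
  interpret ZZ: pair_prob_space "distr M (borel \<Otimes>\<^sub>M borel) ?Z" "distr M borel \<zeta>" ..
  have law: "distr M (borel \<Otimes>\<^sub>M borel) ?Z \<Otimes>\<^sub>M distr M borel \<zeta>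
      = distr M ((borel \<Otimes>\<^sub>M borel) \<Otimes>\<^sub>M borel) (\<lambda>\<omega>. (?Z \<omega>, \<zeta> \<omega>))"
  proof (rule pair_measure_eqI[OF Z.sigma_finite_measure_axioms Ze.sigma_finite_measure_axioms])
    fix A B assume "A \<in> sets (distr M (borel \<Otimes>\<^sub>M borel) ?Z)" "B \<in> sets (distr M borel \<zeta>)"
    then have A: "A \<in> sets (borel \<Otimes>\<^sub>M borel)" and B: "B \<in> sets borel" by simp_all
    have "?Z -` A \<inter> space M \<in> sets F"
      using measurable_sets[OF Z_F A] F by (simp add: subalgebra_def)
    moreover have "\<zeta> -` B \<inter> space M \<in> sets (vimage_algebra (space M) \<zeta> borel)"
      using B by (rule in_vimage_algebra)
    ultimately have "prob ((?Z -` A \<inter> space M) \<inter> (\<zeta> -` B \<inter> space M))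
        = prob (?Z -` A \<inter> space M) * prob (\<zeta> -` B \<inter> space M)"
      using ind unfolding indep_sets2_eq by blast
    moreover have "(?Z -` A \<inter> space M) \<inter> (\<zeta> -` B \<inter> space M)
        = (\<lambda>\<omega>. (?Z \<omega>, \<zeta> \<omega>)) -` (A \<times> B) \<inter> space M" by auto
    ultimately show "emeasure (distr M (borel \<Otimes>\<^sub>M borel) ?Z) A * emeasure (distr M borel \<zeta>) B
        = emeasure (distr M ((borel \<Otimes>\<^sub>M borel) \<Otimes>\<^sub>M borel) (\<lambda>\<omega>. (?Z \<omega>, \<zeta> \<omega>))) (A \<times> B)"
      using A B by (simp add: emeasure_distr emeasure_eq_measure ennreal_mult'')
  qed simp
  let ?g = "\<lambda>w. snd (fst w) * (\<phi> (fst (fst w)) - \<Psi> (fst (fst w) + snd w))"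
  have mg: "?g \<in> borel_measurable ((borel \<Otimes>\<^sub>M borel) \<Otimes>\<^sub>M borel)" by measurable
  have int: "integrable M (\<lambda>\<omega>. ?g (?Z \<omega>, \<zeta> \<omega>))"
  proof (rule integrable_const_bound[where B="K * (2 * c)"])
    show "AE \<omega> in M. norm (?g (?Z \<omega>, \<zeta> \<omega>)) \<le> K * (2 * c)"
    proof (rule AE_I2)
      fix \<omega> assume "\<omega> \<in> space M"
      have "\<bar>\<phi> (X \<omega>) - \<Psi> (X \<omega> + \<zeta> \<omega>)\<bar> \<le> 2 * c"
        using \<phi>_le[of "X \<omega>"] \<Psi>(2)[of "X \<omega> + \<zeta> \<omega>"] by linarith
      then have "\<bar>Y \<omega>\<bar> * \<bar>\<phi> (X \<omega>) - \<Psi> (X \<omega> + \<zeta> \<omega>)\<bar> \<le> K * (2 * c)"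
        using bY[OF \<open>\<omega> \<in> space M\<close>] by (intro mult_mono) auto
      then show "norm (?g (?Z \<omega>, \<zeta> \<omega>)) \<le> K * (2 * c)" by (simp add: abs_mult)
    qed
  qed measurable
  then have ig: "integrable (distr M (borel \<Otimes>\<^sub>M borel) ?Z \<Otimes>\<^sub>M distr M borel \<zeta>) ?g"
    unfolding law by (subst integrable_distr_eq[OF _ mg]) measurable
  \<comment> \<open>By Fubini it suffices to average over the noise with the state held fixed.\<close>
  have inner: "(\<integral>v. ?g (z, v) \<partial>distr M borel \<zeta>) = 0" for z
  proof -
    obtain x y where z: "z = (x, y)" by force
    have iv: "integrable (distr M borel \<zeta>) (\<lambda>v. \<Psi> (x + v))"
      using \<Psi>(2) by (intro Ze.integrable_const_bound[where B=c]) auto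
    have "(\<integral>v. \<Psi> (x + v) \<partial>distr M borel \<zeta>) = (\<integral>\<omega>. \<Psi> (x + \<zeta> \<omega>) \<partial>M)"
      by (subst integral_distr) auto
    also have "\<dots> = \<phi> x"
      unfolding \<phi>_def mean_response_def
      using p by (subst distributed_integral[OF \<zeta>, symmetric]) (auto simp: noise_pdf_def)
    finally show ?thesis using iv Ze.prob_space z
      by (simp add: Bochner_Integration.integral_diff)
  qed
  have "(\<integral>\<omega>. ?g (?Z \<omega>, \<zeta> \<omega>) \<partial>M)
      = (\<integral>w. ?g w \<partial>(distr M (borel \<Otimes>\<^sub>M borel) ?Z \<Otimes>\<^sub>M distr M borel \<zeta>))"
    unfolding law by (subst integral_distr[OF _ mg]) measurable
  also have "\<dots> = (\<integral>z. (\<integral>v. ?g (z, v) \<partial>distr M borel \<zeta>) \<partial>distr M (borel \<Otimes>\<^sub>M borel) ?Z)"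
    by (rule ZZ.integral_fst'[symmetric, OF ig])
  also have "\<dots> = 0" unfolding inner by simp
  finally show ?thesis using int by (simp add: has_bochner_integral_iff \<phi>_def)
qed


section \<open>The drift of consensus and innovations on a connected graph\<close>

text \<open>
  What agent \<open>i\<close> subtracts, up to the step size, written in terms of the errors \<open>e\<close> and with the
  observation noise \<open>\<nu>\<close> and communication noise \<open>\<xi>\<close> of one time step. With the averaged
  nonlinearities and zero noise the same expression gives the conditional mean of that direction.
\<close>

definition direction :: "'v set set \<Rightarrow> ('v \<Rightarrow> real ^ 'm) \<Rightarrow> real \<Rightarrow> (real \<Rightarrow> real) \<Rightarrow> (real \<Rightarrow> real) \<Rightarrow>
    ('v \<Rightarrow> real ^ 'm) \<Rightarrow> ('v \<Rightarrow> real) \<Rightarrow> ('v \<times> 'v \<Rightarrow> real ^ 'm) \<Rightarrow> 'v \<Rightarrow> real ^ 'm" where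
  "direction E h \<beta> \<Psi>\<^sub>o \<Psi>\<^sub>c e \<nu> \<xi> i =
     \<beta> *\<^sub>R (\<Sum>j\<in>neighbors E i. componentwise \<Psi>\<^sub>c (e i - e j + \<xi> (i, j)))
     - \<Psi>\<^sub>o (\<nu> i - h i \<bullet> e i) *\<^sub>R h i"

lemma neighbors_subset: "simple_graph V E \<Longrightarrow> neighbors E i \<subseteq> V"
  by (auto simp: simple_graph_def neighbors_def)

lemma finite_neighbors: "simple_graph V E \<Longrightarrow> finite (neighbors E i)"
  by (metis neighbors_subset rev_finite_subset simple_graph_def)

lemma arcs_Sigma: "simple_graph V E \<Longrightarrow> arcs E = Sigma V (neighbors E)"
  by (auto simp: simple_graph_def neighbors_def arcs_def)

lemma finite_arcs: "simple_graph V E \<Longrightarrow> finite (arcs E)"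
  by (metis arcs_Sigma finite_SigmaI finite_neighbors simple_graph_def)

lemma arcs_sym: "(i, j) \<in> arcs E \<longleftrightarrow> (j, i) \<in> arcs E"
  by (simp add: arcs_def insert_commute)

lemma norm_componentwise_le:
  fixes v :: "real ^ 'm"
  assumes "\<And>u. \<bar>\<Psi> u\<bar> \<le> c"
  shows "norm (componentwise \<Psi> v) \<le> real CARD('m) * c"
proof -
  have "norm (componentwise \<Psi> v) \<le> (\<Sum>l\<in>UNIV. \<bar>componentwise \<Psi> v $ l\<bar>)" by (rule norm_le_l1_cart)
  also have "\<dots> \<le> real CARD('m) * c"
    using sum_bounded_above[of UNIV "\<lambda>l. \<bar>componentwise \<Psi> v $ l\<bar>" c] assms
    by (simp add: componentwise_def)
  finally show ?thesis .
qed

lemma direction_bounded: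
  fixes h :: "'v \<Rightarrow> real ^ 'm"
  assumes G: "simple_graph V E"
    and c: "\<And>u. \<bar>\<Psi>\<^sub>o u\<bar> \<le> c" "\<And>u. \<bar>\<Psi>\<^sub>c u\<bar> \<le> c" and \<beta>: "0 \<le> \<beta>" and i: "i \<in> V"
  shows "norm (direction E h \<beta> \<Psi>\<^sub>o \<Psi>\<^sub>c e \<nu> \<xi> i)
    \<le> \<beta> * (real (card V) * (real CARD('m) * c)) + c * (\<Sum>i\<in>V. norm (h i))"
proof -
  have V: "finite V" using G by (simp add: simple_graph_def)
  have c0: "0 \<le> c" using c(1)[of 0] by linarith
  have "norm (\<Sum>j\<in>neighbors E i. componentwise \<Psi>\<^sub>c (e i - e j + \<xi> (i, j)))
      \<le> (\<Sum>j\<in>neighbors E i. real CARD('m) * c)"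
    by (intro sum_norm_le norm_componentwise_le c)
  also have "\<dots> \<le> real (card V) * (real CARD('m) * c)"
    using card_mono[OF V neighbors_subset[OF G]] c0 by (simp add: mult_right_mono)
  finally have "norm (\<beta> *\<^sub>R (\<Sum>j\<in>neighbors E i. componentwise \<Psi>\<^sub>c (e i - e j + \<xi> (i, j))))
      \<le> \<beta> * (real (card V) * (real CARD('m) * c))"
    using \<beta> by (simp add: mult_left_mono)
  moreover have "norm (\<Psi>\<^sub>o (\<nu> i - h i \<bullet> e i) *\<^sub>R h i) \<le> c * (\<Sum>i\<in>V. norm (h i))"
    using c c0 member_le_sum[OF i, of "\<lambda>i. norm (h i)"] V by (auto intro!: mult_mono)
  ultimately show ?thesis
    unfolding direction_def by (intro order_trans[OF norm_triangle_ineq4] add_mono)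
qed

lemma inner_direction:
  "e i \<bullet> direction E h \<beta> \<Psi>\<^sub>o \<Psi>\<^sub>c e \<nu> \<xi> i =
    \<beta> * (\<Sum>j\<in>neighbors E i. \<Sum>l\<in>UNIV. e i $ l * \<Psi>\<^sub>c ((e i - e j) $ l + \<xi> (i, j) $ l))
    - (h i \<bullet> e i) * \<Psi>\<^sub>o (- (h i \<bullet> e i) + \<nu> i)"
proof -
  have "e i \<bullet> componentwise \<Psi>\<^sub>c (e i - e j + \<xi> (i, j))
      = (\<Sum>l\<in>UNIV. e i $ l * \<Psi>\<^sub>c ((e i - e j) $ l + \<xi> (i, j) $ l))" for j
    by (simp add: componentwise_def inner_vec_def)
  then show ?thesis
    by (simp add: direction_def inner_diff_right inner_sum_right inner_commute[of "e i" "h i"]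
        add.commute[of _ "\<nu> i"] mult.commute[of "h i \<bullet> e i"])
qed

text \<open>
  The drift splits into an edge part and an agent part, and both are sums of terms \<open>u * \<phi> u\<close> with \<open>\<phi>\<close>
  odd. This is the place where symmetry of the graph enters.
\<close>

lemma drift_eq:
  fixes e h :: "'v \<Rightarrow> real ^ 'm"
  assumes G: "simple_graph V E" and odd: "\<And>u. \<phi>\<^sub>o (- u) = - \<phi>\<^sub>o u" "\<And>u. \<phi>\<^sub>c (- u) = - \<phi>\<^sub>c u"
  shows "(\<Sum>i\<in>V. e i \<bullet> direction E h \<beta> \<phi>\<^sub>o \<phi>\<^sub>c e (\<lambda>_. 0) (\<lambda>_. 0) i)
    = \<beta> / 2 * (\<Sum>(i, j)\<in>arcs E. \<Sum>l\<in>UNIV. (e i - e j) $ l * \<phi>\<^sub>c ((e i - e j) $ l))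
      + (\<Sum>i\<in>V. (h i \<bullet> e i) * \<phi>\<^sub>o (h i \<bullet> e i))"
proof -
  have V: "finite V" using G by (simp add: simple_graph_def)
  let ?T = "\<lambda>(i, j). \<Sum>l\<in>UNIV. e i $ l * \<phi>\<^sub>c ((e i - e j) $ l)"
  let ?S = "\<lambda>(i, j). \<Sum>l\<in>UNIV. (e i - e j) $ l * \<phi>\<^sub>c ((e i - e j) $ l)"
  \<comment> \<open>Every edge contributes two opposite arcs; pairing them turns \<open>e i\<close> into \<open>(e i - e j) / 2\<close>.\<close>
  have swap: "sum ?T (arcs E) = (\<Sum>a\<in>arcs E. ?T (prod.swap a))"
    by (rule sum.reindex_bij_witness[of _ prod.swap prod.swap]) (auto simp: arcs_sym)
  have "sum ?T (arcs E) + sum ?T (arcs E) = (\<Sum>a\<in>arcs E. ?T a + ?T (prod.swap a))"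
    by (subst (2) swap) (simp add: sum.distrib)
  also have "\<dots> = sum ?S (arcs E)"
  proof (rule sum.cong[OF refl])
    fix a :: "'v \<times> 'v"
    obtain i j where a: "a = (i, j)" by force
    have "\<phi>\<^sub>c (e j $ l - e i $ l) = - \<phi>\<^sub>c (e i $ l - e j $ l)" for l
      using odd(2)[of "e i $ l - e j $ l"] by simp
    then show "?T a + ?T (prod.swap a) = ?S a"
      by (simp add: a sum.distrib[symmetric] algebra_simps)
  qed
  finally have "sum ?T (arcs E) = sum ?S (arcs E) / 2" by simp
  moreover have "(\<Sum>i\<in>V. \<Sum>j\<in>neighbors E i. ?T (i, j)) = sum ?T (arcs E)"
    using V finite_neighbors[OF G] by (subst sum.Sigma) (auto simp: arcs_Sigma[OF G])
  ultimately show ?thesis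
    by (simp add: inner_direction odd sum.distrib sum_distrib_left[symmetric])
qed

text \<open>
  Monotonicity in \<open>\<bar>u\<bar>\<close> gives lower bounds on the drift that are uniform over an unbounded set of errors.
\<close>

lemma mono_odd_product:
  fixes \<phi> :: "real \<Rightarrow> real"
  assumes "mono \<phi>" "\<And>u. \<phi> (- u) = - \<phi> u" "0 \<le> s" "s \<le> \<bar>u\<bar>"
  shows "s * \<phi> s \<le> u * \<phi> u"
proof -
  have "\<phi> 0 = 0" using assms(2)[of 0] by simp
  then have "0 \<le> \<phi> s" using monoD[OF assms(1) assms(3)] by simp
  moreover have "\<phi> s \<le> \<phi> \<bar>u\<bar>" by (rule monoD[OF assms(1) assms(4)])
  ultimately have "s * \<phi> s \<le> \<bar>u\<bar> * \<phi> \<bar>u\<bar>" using assms(3,4) by (intro mult_mono) auto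
  also have "\<bar>u\<bar> * \<phi> \<bar>u\<bar> = u * \<phi> u" using assms(2)[of u] by (simp add: abs_if)
  finally show ?thesis .
qed

lemma drift_nonneg:
  assumes G: "simple_graph V E" and \<beta>: "0 \<le> \<beta>"
    and odd: "\<And>u. \<phi>\<^sub>o (- u) = - \<phi>\<^sub>o u" "\<And>u. \<phi>\<^sub>c (- u) = - \<phi>\<^sub>c u" and mono: "mono \<phi>\<^sub>o" "mono \<phi>\<^sub>c"
  shows "0 \<le> (\<Sum>i\<in>V. e i \<bullet> direction E h \<beta> \<phi>\<^sub>o \<phi>\<^sub>c e (\<lambda>_. 0) (\<lambda>_. 0) i)"
proof -
  have "0 \<le> u * \<phi>\<^sub>o u" "0 \<le> u * \<phi>\<^sub>c u" for u
    using mono_odd_product[of \<phi>\<^sub>o 0 u] mono_odd_product[of \<phi>\<^sub>c 0 u] odd mono by auto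
  then have "0 \<le> (\<Sum>i\<in>V. (h i \<bullet> e i) * \<phi>\<^sub>o (h i \<bullet> e i))"
    and "0 \<le> (\<Sum>(i, j)\<in>arcs E. \<Sum>l\<in>UNIV. (e i - e j) $ l * \<phi>\<^sub>c ((e i - e j) $ l))"
    by (auto intro!: sum_nonneg simp del: vector_minus_component)
  then show ?thesis
    unfolding drift_eq[where \<phi>\<^sub>o=\<phi>\<^sub>o and \<phi>\<^sub>c=\<phi>\<^sub>c, OF G odd] using \<beta> by simp
qed

text \<open>
  The inner dimension \<open>'c\<close> of the product \<open>columnvector (h i) ** rowvector (h i)\<close> is free: the columns of
  \<open>columnvector\<close> are repeated, and this multiplies the outer product by the positive factor \<open>CARD('c)\<close>.
\<close>

lemma information_matrix_mult:
  fixes h :: "'v \<Rightarrow> real ^ 'm"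
  shows "(\<Sum>i\<in>V. (columnvector (h i) :: real ^ 'c ^ 'm) ** rowvector (h i)) *v y
    = real CARD('c) *\<^sub>R (\<Sum>i\<in>V. (h i \<bullet> y) *\<^sub>R h i)"
proof -
  have "((columnvector (h i) :: real ^ 'c ^ 'm) ** rowvector (h i)) *v y
    = real CARD('c) *\<^sub>R ((h i \<bullet> y) *\<^sub>R h i)" for i
    by (simp add: vec_eq_iff matrix_vector_mult_def matrix_matrix_mult_def columnvector_def
        rowvector_def inner_vec_def sum_distrib_left sum_distrib_right mult_ac)
  moreover have "(\<Sum>i\<in>V. A i) *v y = (\<Sum>i\<in>V. A i *v y)" for A :: "'v \<Rightarrow> real ^ 'm ^ 'm"
    by (induction V rule: infinite_finite_induct) (auto simp: matrix_vector_mult_add_rdistrib)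
  ultimately show ?thesis by (simp add: scaleR_sum_right)
qed

text \<open>
  Connectedness propagates agreement of neighbours from a root \<open>r\<close> to every agent, so that all residuals
  \<open>h i \<bullet> e r\<close> of the single vector \<open>e r\<close> are of order \<open>s\<close>; the injective information matrix then controls \<open>e r\<close>,
  and with it all \<open>e i\<close>.
\<close>

lemma disagreement_and_residuals_bound_error:
  fixes h :: "'v \<Rightarrow> real ^ 'm"
  assumes G: "simple_graph V E" "connected_graph V E"
    and obs: "invertible (\<Sum>i\<in>V. (columnvector (h i) :: real ^ 'c ^ 'm) ** rowvector (h i))"
  obtains K where "0 \<le> K"
    "\<And>e s. \<lbrakk>\<And>i j. (i, j) \<in> arcs E \<Longrightarrow> norm (e i - e j) \<le> s; \<And>i. i \<in> V \<Longrightarrow> \<bar>h i \<bullet> e i\<bar> \<le> s\<rbrakk>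
      \<Longrightarrow> (\<Sum>i\<in>V. (norm (e i))\<^sup>2) \<le> K * s\<^sup>2"
proof (cases "V = {}")
  case True
  then show ?thesis by (intro that[of 0]) auto
next
  case False
  then obtain r where r: "r \<in> V" by blast
  have V: "finite V" using G by (simp add: simple_graph_def)
  let ?near = "\<lambda>(e :: 'v \<Rightarrow> real ^ 'm) s. \<forall>(i, j)\<in>arcs E. norm (e i - e j) \<le> s"
  have "\<exists>L. \<forall>e s. ?near e s \<longrightarrow> norm (e r - e j) \<le> L * s" if "j \<in> V" for j
  proof -
    have "(r, j) \<in> (arcs E)\<^sup>*" using G(2) r that by (simp add: connected_graph_def)
    then show ?thesis
    proof (induction rule: rtrancl_induct)
      case base
      then show ?case by (intro exI[of _ 0]) auto
    next
      case (step y z)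
      then obtain L where L: "\<And>e s. ?near e s \<Longrightarrow> norm (e r - e y) \<le> L * s" by blast
      have "norm (e r - e z) \<le> (L + 1) * s" if "?near e s" for e s
      proof -
        have "norm (e y - e z) \<le> s" using that step(2) by blast
        then show ?thesis
          using L[OF that] norm_triangle_ineq[of "e r - e y" "e y - e z"] by (simp add: algebra_simps)
      qed
      then show ?case by (intro exI[of _ "L + 1"]) auto
    qed
  qed
  then obtain L where L: "\<And>j e s. j \<in> V \<Longrightarrow> ?near e s \<Longrightarrow> norm (e r - e j) \<le> L j * s" by metis
  let ?H = "\<Sum>i\<in>V. (columnvector (h i) :: real ^ 'c ^ 'm) ** rowvector (h i)"
  have "inj ((*v) ?H)" using inj_matrix_vector_mult[OF obs] .
  then obtain B where "0 < B" and B: "\<And>y. B * norm y \<le> norm (?H *v y)"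
    using linear_inj_bounded_below_pos[OF matrix_vector_mul_linear] by blast
  \<comment> \<open>\<open>h i \<bullet> e r\<close> is the residual of agent \<open>i\<close> up to the disagreement between \<open>i\<close> and \<open>r\<close>.\<close>
  define C where "C = real CARD('c) * (\<Sum>i\<in>V. (1 + norm (h i) * L i) * norm (h i)) / B"
  have root: "norm (e r) \<le> C * s" if "?near e s" "\<And>i. i \<in> V \<Longrightarrow> \<bar>h i \<bullet> e i\<bar> \<le> s" for e s
  proof -
    have "\<bar>h i \<bullet> e r\<bar> \<le> (1 + norm (h i) * L i) * s" if "i \<in> V" for i
    proof -
      have "\<bar>h i \<bullet> (e r - e i)\<bar> \<le> norm (h i) * (L i * s)"
        using Cauchy_Schwarz_ineq2[of "h i" "e r - e i"] L[OF \<open>i \<in> V\<close> \<open>?near e s\<close>]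
        by (meson mult_left_mono norm_ge_zero order_trans)
      then show ?thesis
        using \<open>\<And>i. i \<in> V \<Longrightarrow> \<bar>h i \<bullet> e i\<bar> \<le> s\<close>[OF \<open>i \<in> V\<close>]
        by (simp add: inner_diff_right algebra_simps)
    qed
    then have "norm (\<Sum>i\<in>V. (h i \<bullet> e r) *\<^sub>R h i) \<le> (\<Sum>i\<in>V. (1 + norm (h i) * L i) * s * norm (h i))"
      by (intro sum_norm_le) (auto intro!: mult_right_mono)
    then have "norm (?H *v e r) \<le> real CARD('c) * (\<Sum>i\<in>V. (1 + norm (h i) * L i) * s * norm (h i))"
      unfolding information_matrix_mult by simp
    with B[of "e r"] have "B * norm (e r)
        \<le> real CARD('c) * (\<Sum>i\<in>V. (1 + norm (h i) * L i) * s * norm (h i))" by linarith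
    also have "\<dots> = real CARD('c) * (\<Sum>i\<in>V. (1 + norm (h i) * L i) * norm (h i)) * s"
      by (simp add: sum_distrib_left sum_distrib_right mult_ac)
    also have "\<dots> = B * (C * s)" using \<open>0 < B\<close> by (simp add: C_def)
    finally show ?thesis using \<open>0 < B\<close> by simp
  qed
  show ?thesis
  proof (rule that[of "\<Sum>i\<in>V. (C + L i)\<^sup>2"])
    fix e :: "'v \<Rightarrow> real ^ 'm" and s :: real
    assume near: "\<And>i j. (i, j) \<in> arcs E \<Longrightarrow> norm (e i - e j) \<le> s"
      and res: "\<And>i. i \<in> V \<Longrightarrow> \<bar>h i \<bullet> e i\<bar> \<le> s"
    have near': "?near e s" using near by auto
    have "(norm (e i))\<^sup>2 \<le> (C + L i)\<^sup>2 * s\<^sup>2" if "i \<in> V" for i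
    proof -
      have "norm (e i) \<le> (C + L i) * s"
        using root[OF near' res] L[OF that near'] norm_triangle_ineq4[of "e r" "e r - e i"]
        by (simp add: algebra_simps)
      then show ?thesis by (metis norm_ge_zero power_mono power_mult_distrib)
    qed
    then show "(\<Sum>i\<in>V. (norm (e i))\<^sup>2) \<le> (\<Sum>i\<in>V. (C + L i)\<^sup>2) * s\<^sup>2"
      by (simp add: sum_distrib_right sum_mono)
  qed (simp add: sum_nonneg)
qed

text \<open>
  Errors of energy at least \<open>\<epsilon>\<close> have one edge or one agent at which the argument \<open>u\<close> of \<open>u * \<phi> u\<close> is not small,
  and that single term already bounds the nonnegative sum from below.
\<close>

lemma drift_bounded_below:
  fixes h :: "'v \<Rightarrow> real ^ 'm"
  assumes G: "simple_graph V E" "connected_graph V E"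
    and obs: "invertible (\<Sum>i\<in>V. (columnvector (h i) :: real ^ 'c ^ 'm) ** rowvector (h i))"
    and \<beta>: "0 < \<beta>"
    and odd: "\<And>u. \<phi>\<^sub>o (- u) = - \<phi>\<^sub>o u" "\<And>u. \<phi>\<^sub>c (- u) = - \<phi>\<^sub>c u" and mono: "mono \<phi>\<^sub>o" "mono \<phi>\<^sub>c"
    and pos: "\<And>u. 0 < u \<Longrightarrow> 0 < \<phi>\<^sub>o u" "\<And>u. 0 < u \<Longrightarrow> 0 < \<phi>\<^sub>c u" and \<epsilon>: "0 < \<epsilon>"
  obtains \<eta> where "0 < \<eta>"
    "\<And>e. \<epsilon> \<le> (\<Sum>i\<in>V. (norm (e i))\<^sup>2) \<Longrightarrow>
      \<eta> \<le> (\<Sum>i\<in>V. e i \<bullet> direction E h \<beta> \<phi>\<^sub>o \<phi>\<^sub>c e (\<lambda>_. 0) (\<lambda>_. 0) i)"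
proof -
  have V: "finite V" using G by (simp add: simple_graph_def)
  obtain K where "0 \<le> K" and K:
    "\<And>e s. \<lbrakk>\<And>i j. (i, j) \<in> arcs E \<Longrightarrow> norm (e i - e j) \<le> s; \<And>i. i \<in> V \<Longrightarrow> \<bar>h i \<bullet> e i\<bar> \<le> s\<rbrakk>
      \<Longrightarrow> (\<Sum>i\<in>V. (norm (e i))\<^sup>2) \<le> K * s\<^sup>2"
    using disagreement_and_residuals_bound_error[OF G obs] by metis
  \<comment> \<open>Small enough that an error of energy \<open>\<epsilon>\<close> cannot have all disagreements and residuals below \<open>s\<close>.\<close>
  define s where "s = sqrt (\<epsilon> / (K + 1))"
  have s: "0 < s" using \<epsilon> \<open>0 \<le> K\<close> by (simp add: s_def)
  have "K * s\<^sup>2 < \<epsilon>" using \<epsilon> \<open>0 \<le> K\<close> by (simp add: s_def field_simps)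
  \<comment> \<open>A vector of norm above \<open>s\<close> has a coordinate of modulus at least \<open>s'\<close>.\<close>
  define s' where "s' = s / CARD('m)"
  have s': "0 < s'" using s by (simp add: s'_def)
  have nn: "0 \<le> u * \<phi>\<^sub>o u" "0 \<le> u * \<phi>\<^sub>c u" for u
    using mono_odd_product[of \<phi>\<^sub>o 0 u] mono_odd_product[of \<phi>\<^sub>c 0 u] odd mono by auto
  let ?S = "\<lambda>e (i, j). \<Sum>l\<in>UNIV. (e i - e j) $ l * \<phi>\<^sub>c ((e i - e j :: real ^ 'm) $ l)"
  have nn_S: "0 \<le> ?S e a" for e a by (cases a) (auto intro!: sum_nonneg nn simp del: vector_minus_component)
  define \<eta> where "\<eta> = min (\<beta> / 2 * (s' * \<phi>\<^sub>c s')) (s * \<phi>\<^sub>o s)"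
  show thesis
  proof (rule that)
    show "0 < \<eta>" unfolding \<eta>_def using \<beta> s s' pos by simp
    fix e :: "'v \<Rightarrow> real ^ 'm" assume "\<epsilon> \<le> (\<Sum>i\<in>V. (norm (e i))\<^sup>2)"
    with \<open>K * s\<^sup>2 < \<epsilon>\<close> have "\<not> (\<Sum>i\<in>V. (norm (e i))\<^sup>2) \<le> K * s\<^sup>2" by simp
    then have "(\<exists>i j. (i, j) \<in> arcs E \<and> s < norm (e i - e j)) \<or> (\<exists>i\<in>V. s < \<bar>h i \<bullet> e i\<bar>)"
      using K[of e s] by force
    then have "\<eta> \<le> \<beta> / 2 * (\<Sum>a\<in>arcs E. ?S e a) + (\<Sum>i\<in>V. (h i \<bullet> e i) * \<phi>\<^sub>o (h i \<bullet> e i))"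
    proof (elim disjE exE conjE bexE)
      fix i j assume ij: "(i, j) \<in> arcs E" and big: "s < norm (e i - e j)"
      obtain l where l: "s' \<le> \<bar>(e i - e j) $ l\<bar>"
      proof (rule ccontr)
        assume "\<not> thesis"
        then have "\<bar>(e i - e j) $ l\<bar> \<le> s'" for l using that[of l] by (meson linear)
        then have "(\<Sum>l\<in>UNIV. \<bar>(e i - e j) $ l\<bar>) \<le> of_nat CARD('m) * s'"
          by (intro sum_bounded_above)
        then show False using norm_le_l1_cart[of "e i - e j"] big by (simp add: s'_def)
      qed
      have "s' * \<phi>\<^sub>c s' \<le> (e i - e j) $ l * \<phi>\<^sub>c ((e i - e j) $ l)"
        using mono_odd_product[OF mono(2) odd(2) _ l] s' by simp
      also have "\<dots> \<le> ?S e (i, j)"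
        using member_le_sum[of l UNIV "\<lambda>l. (e i - e j) $ l * \<phi>\<^sub>c ((e i - e j) $ l)"] nn by simp
      also have "\<dots> \<le> (\<Sum>a\<in>arcs E. ?S e a)"
        by (rule member_le_sum[OF ij nn_S finite_arcs[OF G(1)]])
      finally have "\<beta> / 2 * (s' * \<phi>\<^sub>c s') \<le> \<beta> / 2 * (\<Sum>a\<in>arcs E. ?S e a)"
        using \<beta> by (intro mult_left_mono) auto
      moreover have "0 \<le> (\<Sum>i\<in>V. (h i \<bullet> e i) * \<phi>\<^sub>o (h i \<bullet> e i))" by (intro sum_nonneg nn)
      ultimately show ?thesis unfolding \<eta>_def by linarith
    next
      fix i assume i: "i \<in> V" and big: "s < \<bar>h i \<bullet> e i\<bar>"
      have "s * \<phi>\<^sub>o s \<le> (h i \<bullet> e i) * \<phi>\<^sub>o (h i \<bullet> e i)"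
        using mono_odd_product[OF mono(1) odd(1), of s] s big by simp
      also have "\<dots> \<le> (\<Sum>i\<in>V. (h i \<bullet> e i) * \<phi>\<^sub>o (h i \<bullet> e i))"
        by (rule member_le_sum[OF i nn(1) V])
      finally have "s * \<phi>\<^sub>o s \<le> (\<Sum>i\<in>V. (h i \<bullet> e i) * \<phi>\<^sub>o (h i \<bullet> e i))" .
      moreover have "0 \<le> \<beta> / 2 * (\<Sum>a\<in>arcs E. ?S e a)"
        using \<beta> nn_S by (intro mult_nonneg_nonneg sum_nonneg) auto
      ultimately show ?thesis unfolding \<eta>_def by linarith
    qed
    then show "\<eta> \<le> (\<Sum>i\<in>V. e i \<bullet> direction E h \<beta> \<phi>\<^sub>o \<phi>\<^sub>c e (\<lambda>_. 0) (\<lambda>_. 0) i)"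
      by (simp add: drift_eq[where \<phi>\<^sub>o=\<phi>\<^sub>o and \<phi>\<^sub>c=\<phi>\<^sub>c, OF G(1) odd])
  qed
qed


section \<open>Almost sure convergence of the iterates\<close>

lemma componentwise_measurable:
  assumes "\<Psi> \<in> borel_measurable borel"
  shows "componentwise \<Psi> \<in> borel_measurable borel"
proof (rule borel_measurable_euclidean_space[THEN iffD2], rule ballI)
  fix b :: "real ^ 'm" assume "b \<in> Basis"
  then obtain l where b: "b = axis l 1" by (auto simp: Basis_vec_def)
  have "(\<lambda>v :: real ^ 'm. v $ l) \<in> borel_measurable borel"
    by (intro borel_measurable_continuous_onI continuous_intros)
  from measurable_compose[OF this assms]
  show "(\<lambda>v. componentwise \<Psi> v \<bullet> b) \<in> borel_measurable borel"
    by (simp add: b componentwise_def inner_axis)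
qed

lemma direction_measurable:
  fixes e :: "'a \<Rightarrow> 'v \<Rightarrow> real ^ 'm"
  assumes G: "simple_graph V E" and i: "i \<in> V"
    and \<Psi>: "\<Psi>\<^sub>o \<in> borel_measurable borel" "\<Psi>\<^sub>c \<in> borel_measurable borel"
    and e: "\<And>i. i \<in> V \<Longrightarrow> (\<lambda>\<omega>. e \<omega> i) \<in> borel_measurable F"
    and \<nu>: "\<And>i. i \<in> V \<Longrightarrow> (\<lambda>\<omega>. \<nu> \<omega> i) \<in> borel_measurable F"
    and \<xi>: "\<And>c. c \<in> arcs E \<Longrightarrow> (\<lambda>\<omega>. \<xi> \<omega> c) \<in> borel_measurable F"
  shows "(\<lambda>\<omega>. direction E h \<beta> \<Psi>\<^sub>o \<Psi>\<^sub>c (e \<omega>) (\<nu> \<omega>) (\<xi> \<omega>) i) \<in> borel_measurable F"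
  unfolding direction_def
proof (intro borel_measurable_diff borel_measurable_scaleR borel_measurable_sum borel_measurable_const)
  fix j assume j: "j \<in> neighbors E i"
  then have "j \<in> V" "(i, j) \<in> arcs E" using neighbors_subset[OF G] by (auto simp: neighbors_def arcs_def)
  then have "(\<lambda>\<omega>. e \<omega> i - e \<omega> j + \<xi> \<omega> (i, j)) \<in> borel_measurable F"
    using e i \<xi> by (intro borel_measurable_add borel_measurable_diff) auto
  from measurable_compose[OF this componentwise_measurable[OF \<Psi>(2)]]
  show "(\<lambda>\<omega>. componentwise \<Psi>\<^sub>c (e \<omega> i - e \<omega> j + \<xi> \<omega> (i, j))) \<in> borel_measurable F" .
next
  have "(\<lambda>\<omega>. \<nu> \<omega> i - h i \<bullet> e \<omega> i) \<in> borel_measurable F"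
    using e[OF i] \<nu>[OF i] by measurable
  from measurable_compose[OF this \<Psi>(1)]
  show "(\<lambda>\<omega>. \<Psi>\<^sub>o (\<nu> \<omega> i - h i \<bullet> e \<omega> i)) \<in> borel_measurable F" .
qed

text \<open>
  The difference is a finite sum of scalar fluctuations, each of which involves one observation noise or
  one coordinate of one communication noise. By linearity, noises of the same time step may depend on each other.
\<close>

lemma (in prob_space) direction_fluctuation_orthogonal:
  fixes e :: "'a \<Rightarrow> 'v \<Rightarrow> real ^ 'm"
  assumes G: "simple_graph V E" and F: "subalgebra M F"
    and e: "\<And>i. i \<in> V \<Longrightarrow> (\<lambda>\<omega>. e \<omega> i) \<in> borel_measurable F"
      "\<And>i \<omega>. i \<in> V \<Longrightarrow> \<omega> \<in> space M \<Longrightarrow> norm (e \<omega> i) \<le> R"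
    and Y: "Y \<in> borel_measurable F" "\<And>\<omega>. \<omega> \<in> space M \<Longrightarrow> \<bar>Y \<omega>\<bar> \<le> K"
    and \<nu>: "\<And>i. i \<in> V \<Longrightarrow> distributed M lborel (\<lambda>\<omega>. \<nu> \<omega> i) (\<lambda>u. ennreal (p\<^sub>o u))"
      "\<And>i. i \<in> V \<Longrightarrow> indep_set (sets F) (sets (vimage_algebra (space M) (\<lambda>\<omega>. \<nu> \<omega> i) borel))"
    and \<xi>: "\<And>c l. c \<in> arcs E \<Longrightarrow> distributed M lborel (\<lambda>\<omega>. \<xi> \<omega> c $ l) (\<lambda>u. ennreal (p\<^sub>c u))"
      "\<And>c l. c \<in> arcs E \<Longrightarrow> indep_set (sets F) (sets (vimage_algebra (space M) (\<lambda>\<omega>. \<xi> \<omega> c $ l) borel))"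
    and p: "noise_pdf p\<^sub>o" "noise_pdf p\<^sub>c"
    and \<Psi>: "mono \<Psi>\<^sub>o" "\<And>u. \<bar>\<Psi>\<^sub>o u\<bar> \<le> c" "mono \<Psi>\<^sub>c" "\<And>u. \<bar>\<Psi>\<^sub>c u\<bar> \<le> c"
  shows "(\<integral>\<omega>. Y \<omega> * (\<Sum>i\<in>V. e \<omega> i \<bullet>
      (direction E h \<beta> (mean_response p\<^sub>o \<Psi>\<^sub>o) (mean_response p\<^sub>c \<Psi>\<^sub>c) (e \<omega>) (\<lambda>_. 0) (\<lambda>_. 0) i
       - direction E h \<beta> \<Psi>\<^sub>o \<Psi>\<^sub>c (e \<omega>) (\<nu> \<omega>) (\<xi> \<omega>) i)) \<partial>M) = 0"
proof -
  let ?\<phi>\<^sub>o = "mean_response p\<^sub>o \<Psi>\<^sub>o" and ?\<phi>\<^sub>c = "mean_response p\<^sub>c \<Psi>\<^sub>c"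
  let ?c = "\<lambda>i j l \<omega>. Y \<omega> * e \<omega> i $ l *
    (?\<phi>\<^sub>c ((e \<omega> i - e \<omega> j) $ l) - \<Psi>\<^sub>c ((e \<omega> i - e \<omega> j) $ l + \<xi> \<omega> (i, j) $ l))"
  let ?o = "\<lambda>i \<omega>. Y \<omega> * (h i \<bullet> e \<omega> i) *
    (?\<phi>\<^sub>o (- (h i \<bullet> e \<omega> i)) - \<Psi>\<^sub>o (- (h i \<bullet> e \<omega> i) + \<nu> \<omega> i))"
  have nth: "(\<lambda>v :: real ^ 'm. v $ l) \<in> borel_measurable borel" for l
    by (intro borel_measurable_continuous_onI continuous_intros)
  have c: "has_bochner_integral M (?c i j l) 0" if i: "i \<in> V" and j: "j \<in> neighbors E i" for i j l
  proof (rule fluctuation_orthogonal[OF F _ _ _ \<xi>(1) p(2) \<xi>(2) \<Psi>(3,4)])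
    have "j \<in> V" using j neighbors_subset[OF G] by auto
    have "(\<lambda>\<omega>. e \<omega> i - e \<omega> j) \<in> borel_measurable F"
      using e(1)[OF i] e(1)[OF \<open>j \<in> V\<close>] by measurable
    from measurable_compose[OF this nth] show "(\<lambda>\<omega>. (e \<omega> i - e \<omega> j) $ l) \<in> borel_measurable F" .
    show "(\<lambda>\<omega>. Y \<omega> * e \<omega> i $ l) \<in> borel_measurable F"
      using Y(1) measurable_compose[OF e(1)[OF i] nth] by measurable
    show "\<bar>Y \<omega> * e \<omega> i $ l\<bar> \<le> K * R" if "\<omega> \<in> space M" for \<omega>
      unfolding abs_mult using Y(2)[OF that] e(2)[OF i that] component_le_norm_cart[of "e \<omega> i" l]
      by (intro mult_mono) auto
    show "(i, j) \<in> arcs E" "(i, j) \<in> arcs E" using j by (auto simp: arcs_def neighbors_def)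
  qed
  have o: "has_bochner_integral M (?o i) 0" if i: "i \<in> V" for i
  proof (rule fluctuation_orthogonal[OF F _ _ _ \<nu>(1)[OF i] p(1) \<nu>(2)[OF i] \<Psi>(1,2)])
    show "(\<lambda>\<omega>. - (h i \<bullet> e \<omega> i)) \<in> borel_measurable F" using e(1)[OF i] by measurable
    show "(\<lambda>\<omega>. Y \<omega> * (h i \<bullet> e \<omega> i)) \<in> borel_measurable F" using e(1)[OF i] Y(1) by measurable
    show "\<bar>Y \<omega> * (h i \<bullet> e \<omega> i)\<bar> \<le> K * (norm (h i) * R)" if "\<omega> \<in> space M" for \<omega>
    proof -
      have "\<bar>h i \<bullet> e \<omega> i\<bar> \<le> norm (h i) * R"
        using Cauchy_Schwarz_ineq2[of "h i" "e \<omega> i"] mult_left_mono[OF e(2)[OF i that], of "norm (h i)"]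
        by simp
      then show ?thesis unfolding abs_mult using Y(2)[OF that] by (intro mult_mono) auto
    qed
  qed
  have "has_bochner_integral M (\<lambda>\<omega>. \<Sum>i\<in>V. \<beta> * (\<Sum>j\<in>neighbors E i. \<Sum>l\<in>UNIV. ?c i j l \<omega>) - ?o i \<omega>)
      (\<Sum>i\<in>V. \<beta> * (\<Sum>j\<in>neighbors E i. \<Sum>l\<in>(UNIV :: 'm set). 0) - 0)"
    by (intro has_bochner_integral_sum has_bochner_integral_diff has_bochner_integral_mult_right c o)
  moreover have "(\<Sum>i\<in>V. \<beta> * (\<Sum>j\<in>neighbors E i. \<Sum>l\<in>UNIV. ?c i j l \<omega>) - ?o i \<omega>) =
      Y \<omega> * (\<Sum>i\<in>V. e \<omega> i \<bullet>
      (direction E h \<beta> ?\<phi>\<^sub>o ?\<phi>\<^sub>c (e \<omega>) (\<lambda>_. 0) (\<lambda>_. 0) i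
       - direction E h \<beta> \<Psi>\<^sub>o \<Psi>\<^sub>c (e \<omega>) (\<nu> \<omega>) (\<xi> \<omega>) i))" for \<omega>
  proof (subst sum_distrib_left, rule sum.cong[OF refl])
    fix i
    have "e \<omega> i \<bullet> (direction E h \<beta> ?\<phi>\<^sub>o ?\<phi>\<^sub>c (e \<omega>) (\<lambda>_. 0) (\<lambda>_. 0) i
          - direction E h \<beta> \<Psi>\<^sub>o \<Psi>\<^sub>c (e \<omega>) (\<nu> \<omega>) (\<xi> \<omega>) i)
        = \<beta> * (\<Sum>j\<in>neighbors E i. \<Sum>l\<in>UNIV. e \<omega> i $ l *
            (?\<phi>\<^sub>c ((e \<omega> i - e \<omega> j) $ l) - \<Psi>\<^sub>c ((e \<omega> i - e \<omega> j) $ l + \<xi> \<omega> (i, j) $ l)))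
          - (h i \<bullet> e \<omega> i) * (?\<phi>\<^sub>o (- (h i \<bullet> e \<omega> i)) - \<Psi>\<^sub>o (- (h i \<bullet> e \<omega> i) + \<nu> \<omega> i))"
      by (simp add: inner_diff_right inner_direction right_diff_distrib sum_subtractf)
    then show "\<beta> * (\<Sum>j\<in>neighbors E i. \<Sum>l\<in>UNIV. ?c i j l \<omega>) - ?o i \<omega> = Y \<omega> * (e \<omega> i \<bullet>
        (direction E h \<beta> ?\<phi>\<^sub>o ?\<phi>\<^sub>c (e \<omega>) (\<lambda>_. 0) (\<lambda>_. 0) i
         - direction E h \<beta> \<Psi>\<^sub>o \<Psi>\<^sub>c (e \<omega>) (\<nu> \<omega>) (\<xi> \<omega>) i))"
      by (simp add: right_diff_distrib[of "Y \<omega>"] sum_distrib_left mult.assoc mult.left_commute[of "Y \<omega>" \<beta>])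
  qed
  ultimately show ?thesis by (simp add: has_bochner_integral_iff)
qed

theorem theorem1:
  fixes P :: "'w measure"
    and N :: nat and E :: "nat set set"
    and \<theta> :: "real ^ 'm" and h x0 :: "nat \<Rightarrow> real ^ 'm"
    and n z :: "nat \<Rightarrow> nat \<Rightarrow> 'w \<Rightarrow> real"
    and \<xi> :: "nat \<times> nat \<Rightarrow> nat \<Rightarrow> 'w \<Rightarrow> real ^ 'm"
    and x :: "nat \<Rightarrow> nat \<Rightarrow> 'w \<Rightarrow> real ^ 'm"
    and p\<^sub>o p\<^sub>c \<Psi>\<^sub>o \<Psi>\<^sub>c :: "real \<Rightarrow> real"
    and \<alpha> :: "nat \<Rightarrow> real" and a b \<delta> :: real
  assumes prob: "prob_space P"
    and N: "N \<ge> 2"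
    and graph: "simple_graph {1..N} E" "connected_graph {1..N} E"
    and h_nonzero: "\<And>i. i \<in> {1..N} \<Longrightarrow> h i \<noteq> 0"
    and observable: "invertible (\<Sum>i\<in>{1..N}. columnvector (h i) ** rowvector (h i))"
    and observation:
      "\<And>i t \<omega>. i \<in> {1..N} \<Longrightarrow> \<omega> \<in> space P \<Longrightarrow> z i t \<omega> = h i \<bullet> \<theta> + n i t \<omega>"
    and p\<^sub>o: "noise_pdf p\<^sub>o"
    and n_indep: "prob_space.indep_vars P (\<lambda>_. borel) (\<lambda>(i, t). n i t) ({1..N} \<times> UNIV)"
    and n_pdf: "\<And>i t. i \<in> {1..N} \<Longrightarrow> distributed P lborel (n i t) (\<lambda>u. ennreal (p\<^sub>o u))"
    and p\<^sub>c: "noise_pdf p\<^sub>c"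
    and \<xi>_iid: "\<And>e. e \<in> arcs E \<Longrightarrow> iid P borel (\<xi> e)"
    and \<xi>_indep: "prob_space.indep_vars P (\<lambda>_. borel) (\<lambda>(e, t). \<xi> e t) (arcs E \<times> UNIV)"
    and \<xi>_pdf: "\<And>e t l. e \<in> arcs E \<Longrightarrow>
      distributed P lborel (\<lambda>\<omega>. \<xi> e t \<omega> $ l) (\<lambda>u. ennreal (p\<^sub>c u))"
    and joint_iid:
      "iid P ((\<Pi>\<^sub>M i\<in>{1..N}. borel) \<Otimes>\<^sub>M (\<Pi>\<^sub>M e\<in>arcs E. borel))
        (\<lambda>t \<omega>. (\<lambda>i\<in>{1..N}. n i t \<omega>, \<lambda>e\<in>arcs E. \<xi> e t \<omega>))"
    and \<Psi>: "admissible_nonlinearity \<Psi>\<^sub>o" "admissible_nonlinearity \<Psi>\<^sub>c"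
    and params: "a > 0" "b > 0" "1/2 < \<delta>" "\<delta> \<le> 1"
    and step: "\<And>t. \<alpha> t = a / (real t + 1) powr \<delta>"
    and x_0: "\<And>i \<omega>. i \<in> {1..N} \<Longrightarrow> \<omega> \<in> space P \<Longrightarrow> x i 0 \<omega> = x0 i"
    and x_Suc: "\<And>i t \<omega>. i \<in> {1..N} \<Longrightarrow> \<omega> \<in> space P \<Longrightarrow>
      x i (Suc t) \<omega> = x i t \<omega> - \<alpha> t *\<^sub>R
        ((b / a) *\<^sub>R (\<Sum>j\<in>neighbors E i.
            componentwise \<Psi>\<^sub>c (x i t \<omega> - x j t \<omega> + \<xi> (i, j) t \<omega>))
         - \<Psi>\<^sub>o (z i t \<omega> - h i \<bullet> x i t \<omega>) *\<^sub>R h i)"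
  shows "\<forall>i\<in>{1..N}. AE \<omega> in P. (\<lambda>t. x i t \<omega>) \<longlonglongrightarrow> \<theta>"
proof -
  interpret prob_space P by (rule prob)
  let ?V = "{1..N}" and ?\<beta> = "b / a"
  let ?\<phi>\<^sub>o = "mean_response p\<^sub>o \<Psi>\<^sub>o" and ?\<phi>\<^sub>c = "mean_response p\<^sub>c \<Psi>\<^sub>c"
  have \<beta>: "0 < ?\<beta>" using params by simp
  have mono: "mono \<Psi>\<^sub>o" "mono \<Psi>\<^sub>c" and odd: "\<And>u. \<Psi>\<^sub>o (- u) = - \<Psi>\<^sub>o u" "\<And>u. \<Psi>\<^sub>c (- u) = - \<Psi>\<^sub>c u"
    using \<Psi> by (auto simp: admissible_nonlinearity_def)
  obtain c\<^sub>o c\<^sub>c where "\<And>u. \<bar>\<Psi>\<^sub>o u\<bar> \<le> c\<^sub>o" "\<And>u. \<bar>\<Psi>\<^sub>c u\<bar> \<le> c\<^sub>c"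
    using \<Psi> by (auto simp: admissible_nonlinearity_def)
  then obtain c where c: "\<And>u. \<bar>\<Psi>\<^sub>o u\<bar> \<le> c" "\<And>u. \<bar>\<Psi>\<^sub>c u\<bar> \<le> c"
    by (metis max.cobounded1 max.cobounded2 order_trans)
  note meas = borel_measurable_mono[OF mono(1)] borel_measurable_mono[OF mono(2)]
  have c_\<phi>: "\<And>u. \<bar>?\<phi>\<^sub>o u\<bar> \<le> c" "\<And>u. \<bar>?\<phi>\<^sub>c u\<bar> \<le> c"
    using mean_response_bounded[OF p\<^sub>o meas(1) c(1)] mean_response_bounded[OF p\<^sub>c meas(2) c(2)] by auto
  have odd_\<phi>: "\<And>u. ?\<phi>\<^sub>o (- u) = - ?\<phi>\<^sub>o u" "\<And>u. ?\<phi>\<^sub>c (- u) = - ?\<phi>\<^sub>c u"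
    by (rule mean_response_odd, rule p\<^sub>o p\<^sub>c, rule odd)+
  have mono_\<phi>: "mono ?\<phi>\<^sub>o" "mono ?\<phi>\<^sub>c"
    using mean_response_mono[OF p\<^sub>o mono(1) c(1)] mean_response_mono[OF p\<^sub>c mono(2) c(2)] by auto
  note meas_\<phi> = borel_measurable_mono[OF mono_\<phi>(1)] borel_measurable_mono[OF mono_\<phi>(2)]
  define e where "e t \<omega> i = x i t \<omega> - \<theta>" for t \<omega> i
  \<comment> \<open>The recursion in error form: \<open>g\<close> is the actual direction, \<open>f\<close> its average over the noise.\<close>
  define g where "g t \<omega> i = direction E h ?\<beta> \<Psi>\<^sub>o \<Psi>\<^sub>c (e t \<omega>) (\<lambda>i. n i t \<omega>) (\<lambda>c. \<xi> c t \<omega>) i" for t \<omega> i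
  define f where "f t \<omega> i = direction E h ?\<beta> ?\<phi>\<^sub>o ?\<phi>\<^sub>c (e t \<omega>) (\<lambda>_. 0) (\<lambda>_. 0) i" for t \<omega> i
  have e_0: "e 0 \<omega> i = x0 i - \<theta>" if "i \<in> ?V" "\<omega> \<in> space P" for i \<omega>
    using x_0[OF that] by (simp add: e_def)
  have e_Suc: "e (Suc t) \<omega> i = e t \<omega> i - \<alpha> t *\<^sub>R g t \<omega> i" if "i \<in> ?V" "\<omega> \<in> space P" for i \<omega> t
  proof -
    have "z i t \<omega> - h i \<bullet> x i t \<omega> = n i t \<omega> - h i \<bullet> e t \<omega> i"
      using observation[OF that] by (simp add: e_def inner_diff_right)
    then show ?thesis using x_Suc[OF that] by (simp add: g_def direction_def e_def)
  qed
  define B where "B = ?\<beta> * (real (card ?V) * (real CARD('m) * c)) + c * (\<Sum>i\<in>?V. norm (h i))"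
  have g_le: "norm (g t \<omega> i) \<le> B" and f_le: "norm (f t \<omega> i) \<le> B" if "i \<in> ?V" for i t \<omega>
    unfolding g_def f_def B_def
    by (rule direction_bounded[OF graph(1) _ _ _ that]; use c c_\<phi> \<beta> in simp)+
  have \<alpha>_pos: "0 \<le> \<alpha> t" for t using params by (simp add: step)
  \<comment> \<open>A deterministic bound at each time, which grows with \<open>t\<close>; it makes the expectations below finite.\<close>
  have "\<exists>R. \<forall>i\<in>?V. \<forall>\<omega>\<in>space P. norm (e t \<omega> i) \<le> R" for t
  proof (induction t)
    case 0
    have "norm (e 0 \<omega> i) \<le> (\<Sum>i\<in>?V. norm (x0 i - \<theta>))" if "i \<in> ?V" "\<omega> \<in> space P" for i \<omega>
      unfolding e_0[OF that] by (rule member_le_sum[OF that(1), of "\<lambda>i. norm (x0 i - \<theta>)"]) auto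
    then show ?case by (intro exI ballI)
  next
    case (Suc t)
    then obtain R where R: "\<And>i \<omega>. i \<in> ?V \<Longrightarrow> \<omega> \<in> space P \<Longrightarrow> norm (e t \<omega> i) \<le> R" by blast
    have "norm (e (Suc t) \<omega> i) \<le> R + \<alpha> t * B" if "i \<in> ?V" "\<omega> \<in> space P" for i \<omega>
      unfolding e_Suc[OF that] using R[OF that] mult_left_mono[OF g_le[OF that(1), of t \<omega>] \<alpha>_pos[of t]] \<alpha>_pos[of t]
      by (intro order_trans[OF norm_triangle_ineq4]) simp
    then show ?case by (intro exI ballI)
  qed
  then obtain R where R: "\<And>t i \<omega>. i \<in> ?V \<Longrightarrow> \<omega> \<in> space P \<Longrightarrow> norm (e t \<omega> i) \<le> R t" by metis

  let ?S = "(\<Pi>\<^sub>M i\<in>?V. (borel :: real measure)) \<Otimes>\<^sub>M (\<Pi>\<^sub>M c\<in>arcs E. (borel :: (real ^ 'm) measure))"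
  \<comment> \<open>All noise of one time step, kept together because its components may depend on each other.\<close>
  define W where "W t \<omega> = (\<lambda>i\<in>?V. n i t \<omega>, \<lambda>c\<in>arcs E. \<xi> c t \<omega>)" for t \<omega>
  have W: "indep_vars (\<lambda>_. ?S) W UNIV" and W_rv: "W t \<in> measurable P ?S" for t
    using joint_iid unfolding W_def[abs_def] iid_def identically_distributed_def by auto
  \<comment> \<open>\<open>F t\<close> is generated by the noise before time \<open>t\<close>, so it makes the iterates at time \<open>t\<close> measurable.\<close>
  define F where "F = past P ?S W"
  have F: "subalgebra P (F t)" for t unfolding F_def by (rule subalgebra_past[OF W_rv])
  have F_mono: "sets (F s) \<subseteq> sets (F t)" if "s \<le> t" for s t
    unfolding F_def by (rule past_mono[OF W_rv that])
  have lift: "f \<in> measurable (F t) A" if "f \<in> measurable (F s) A" "s \<le> t" for f s t and A :: "'b measure"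
    using that(1) F_mono[OF that(2)] F[of s] F[of t] unfolding subalgebra_def
    by (auto simp: measurable_def)
  have W_F: "W t \<in> measurable (F (Suc t)) ?S" for t
    unfolding F_def by (rule measurable_past[OF W_rv]) simp
  have \<nu>_S: "(\<lambda>w. fst w i) \<in> borel_measurable ?S" if "i \<in> ?V" for i
    using that by (intro measurable_compose[OF measurable_fst] measurable_component_singleton)
  have \<xi>_S: "(\<lambda>w. snd w c) \<in> borel_measurable ?S" if "c \<in> arcs E" for c
    using that by (intro measurable_compose[OF measurable_snd] measurable_component_singleton)
  have \<xi>l_S: "(\<lambda>w. snd w c $ l) \<in> borel_measurable ?S" if "c \<in> arcs E" for c l
    by (rule measurable_compose[OF \<xi>_S[OF that]])
       (intro borel_measurable_continuous_onI continuous_intros)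
  have n_F: "n i t \<in> borel_measurable (F (Suc t))" if "i \<in> ?V" for i t
    using measurable_compose[OF W_F \<nu>_S[OF that]] that by (simp add: W_def)
  have \<xi>_F: "\<xi> c t \<in> borel_measurable (F (Suc t))" if "c \<in> arcs E" for c t
    using measurable_compose[OF W_F \<xi>_S[OF that]] that by (simp add: W_def)
  have n_ind: "indep_set (sets (F t)) (sets (vimage_algebra (space P) (n i t) borel))" if "i \<in> ?V" for i t
    using past_indep[OF W \<nu>_S[OF that], of t] that by (simp add: F_def W_def)
  have \<xi>_ind: "indep_set (sets (F t)) (sets (vimage_algebra (space P) (\<lambda>\<omega>. \<xi> c t \<omega> $ l) borel))"
    if "c \<in> arcs E" for c t l
    using past_indep[OF W \<xi>l_S[OF that], of t] that by (simp add: F_def W_def)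

  have g_F': "(\<lambda>\<omega>. g t \<omega> i) \<in> borel_measurable (F (Suc t))"
    if "i \<in> ?V" "\<And>i. i \<in> ?V \<Longrightarrow> (\<lambda>\<omega>. e t \<omega> i) \<in> borel_measurable (F t)" for t i
    unfolding g_def using that lift[OF that(2)] n_F \<xi>_F
    by (intro direction_measurable[OF graph(1)] meas) auto
  have e_F: "(\<lambda>\<omega>. e t \<omega> i) \<in> borel_measurable (F t)" if "i \<in> ?V" for t i
    using that
  proof (induction t arbitrary: i)
    case 0
    have "(\<lambda>\<omega>. x0 i - \<theta>) \<in> borel_measurable (F 0)" by simp
    then show ?case
      by (rule measurable_cong[THEN iffD1, rotated]) (use e_0 0 F in \<open>auto simp: subalgebra_def\<close>)
  next
    case (Suc t)
    have "(\<lambda>\<omega>. e t \<omega> i - \<alpha> t *\<^sub>R g t \<omega> i) \<in> borel_measurable (F (Suc t))"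
      using g_F'[OF Suc(2,1)] lift[OF Suc(1)[OF Suc(2)], of "Suc t"] by simp
    then show ?case
      by (rule measurable_cong[THEN iffD1, rotated]) (use e_Suc Suc(2) F in \<open>auto simp: subalgebra_def\<close>)
  qed
  note g_F = g_F'[OF _ e_F]
  have f_F: "(\<lambda>\<omega>. f t \<omega> i) \<in> borel_measurable (F t)" if "i \<in> ?V" for t i
    unfolding f_def using that e_F
    by (intro direction_measurable[OF graph(1)] meas_\<phi>) auto

  \<comment> \<open>The terms in the expansion of one step of the squared error, as the Lyapunov criterion needs them.\<close>
  define U where "U t \<omega> = (\<Sum>i\<in>?V. (norm (e t \<omega> i))\<^sup>2)" for t \<omega>
  define D where "D t \<omega> = (\<Sum>i\<in>?V. e t \<omega> i \<bullet> f t \<omega> i)" for t \<omega>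
  define d where "d t \<omega> = (\<Sum>i\<in>?V. e t \<omega> i \<bullet> (f t \<omega> i - g t \<omega> i))" for t \<omega>
  define r where "r t \<omega> = (\<Sum>i\<in>?V. (norm (g t \<omega> i))\<^sup>2)" for t \<omega>
  have rec: "U (Suc t) \<omega> = U t \<omega> - \<alpha> t * (2 * D t \<omega>) + \<alpha> t * (2 * d t \<omega>) + (\<alpha> t)\<^sup>2 * r t \<omega>"
    if \<omega>: "\<omega> \<in> space P" for t \<omega>
  proof -
    have "(norm (e (Suc t) \<omega> i))\<^sup>2 = (norm (e t \<omega> i))\<^sup>2 - \<alpha> t * (2 * (e t \<omega> i \<bullet> f t \<omega> i))
        + \<alpha> t * (2 * (e t \<omega> i \<bullet> (f t \<omega> i - g t \<omega> i))) + (\<alpha> t)\<^sup>2 * (norm (g t \<omega> i))\<^sup>2" if "i \<in> ?V" for i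
      unfolding e_Suc[OF that \<omega>] power2_norm_eq_inner
      by (simp add: inner_diff_left inner_diff_right inner_commute[of "g t \<omega> i" "e t \<omega> i"]
          power2_eq_square algebra_simps)
    then have "U (Suc t) \<omega> = (\<Sum>i\<in>?V. (norm (e t \<omega> i))\<^sup>2 - \<alpha> t * (2 * (e t \<omega> i \<bullet> f t \<omega> i))
        + \<alpha> t * (2 * (e t \<omega> i \<bullet> (f t \<omega> i - g t \<omega> i))) + (\<alpha> t)\<^sup>2 * (norm (g t \<omega> i))\<^sup>2)"
      unfolding U_def by (rule sum.cong[OF refl])
    then show ?thesis
      unfolding U_def D_def d_def r_def by (simp only: sum.distrib sum_subtractf sum_distrib_left[symmetric])
  qed
  have d_le: "(d t \<omega>)\<^sup>2 \<le> 4 * B\<^sup>2 * real N * U t \<omega>" for t \<omega>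
  proof -
    have "\<bar>d t \<omega>\<bar> \<le> (\<Sum>i\<in>?V. 2 * B * norm (e t \<omega> i))"
      unfolding d_def
    proof (intro order_trans[OF sum_abs] sum_mono)
      fix i assume i: "i \<in> ?V"
      have "norm (f t \<omega> i - g t \<omega> i) \<le> 2 * B"
        using norm_triangle_ineq4[of "f t \<omega> i" "g t \<omega> i"] f_le[OF i, of t \<omega>] g_le[OF i, of t \<omega>] by linarith
      from mult_left_mono[OF this norm_ge_zero[of "e t \<omega> i"]]
      show "\<bar>e t \<omega> i \<bullet> (f t \<omega> i - g t \<omega> i)\<bar> \<le> 2 * B * norm (e t \<omega> i)"
        using Cauchy_Schwarz_ineq2[of "e t \<omega> i" "f t \<omega> i - g t \<omega> i"] by (simp add: mult_ac)
    qed
    from power_mono[OF this abs_ge_zero, of 2]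
    have "(d t \<omega>)\<^sup>2 \<le> (\<Sum>i\<in>?V. 2 * B * norm (e t \<omega> i))\<^sup>2" by simp
    also have "\<dots> = (2 * B)\<^sup>2 * (\<Sum>i\<in>?V. norm (e t \<omega> i))\<^sup>2"
      by (simp add: sum_distrib_left[symmetric] power_mult_distrib)
    also have "\<dots> \<le> (2 * B)\<^sup>2 * (U t \<omega> * real N)"
      using sum_squared_le_sum_of_squares[of "\<lambda>i. norm (e t \<omega> i)" ?V]
      unfolding U_def by (intro mult_left_mono) auto
    finally show ?thesis by (simp add: power_mult_distrib mult_ac)
  qed
  have U_le: "U t \<omega> \<le> real N * (R t)\<^sup>2" if "\<omega> \<in> space P" for t \<omega>
    using sum_bounded_above[of ?V "\<lambda>i. (norm (e t \<omega> i))\<^sup>2" "(R t)\<^sup>2"] R[OF _ that]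
    unfolding U_def by (simp add: power_mono)
  have U_meas: "U t \<in> borel_measurable P" for t
    unfolding U_def[abs_def] using measurable_from_subalg[OF F e_F]
    by (intro borel_measurable_sum borel_measurable_power borel_measurable_norm) auto
  have U_nn: "0 \<le> U t \<omega>" for t \<omega> unfolding U_def by (simp add: sum_nonneg)
  have U_int: "integrable P (U t)" for t
    using U_le U_nn by (intro integrable_const_bound[where B="real N * (R t)\<^sup>2"] U_meas) auto
  have d_F: "d t \<in> borel_measurable (F (Suc t))" for t
    unfolding d_def[abs_def] using lift[OF e_F] lift[OF f_F] g_F
    by (intro borel_measurable_sum borel_measurable_inner borel_measurable_diff) auto
  have d_int: "integrable P (\<lambda>\<omega>. (d t \<omega>)\<^sup>2)" for t
  proof (rule Bochner_Integration.integrable_bound)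
    show "integrable P (\<lambda>\<omega>. 4 * B\<^sup>2 * real N * U t \<omega>)" using U_int by simp
    show "(\<lambda>\<omega>. (d t \<omega>)\<^sup>2) \<in> borel_measurable P"
      using measurable_from_subalg[OF F d_F] by (rule borel_measurable_power)
    show "AE \<omega> in P. norm ((d t \<omega>)\<^sup>2) \<le> norm (4 * B\<^sup>2 * real N * U t \<omega>)"
      using d_le by (intro AE_I2) (metis abs_ge_self abs_power2 order_trans real_norm_def)
  qed
  have "martingale_differences P F d"
    unfolding martingale_differences_def
  proof (intro conjI allI impI)
    fix t and Y :: "'w \<Rightarrow> real" and K assume "Y \<in> borel_measurable (F t)" "\<forall>\<omega>\<in>space P. \<bar>Y \<omega>\<bar> \<le> K"
    then show "(\<integral>\<omega>. Y \<omega> * d t \<omega> \<partial>P) = 0"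
      unfolding d_def f_def g_def
      by (intro direction_fluctuation_orthogonal[OF graph(1) F e_F R _ _ n_pdf n_ind \<xi>_pdf \<xi>_ind
            p\<^sub>o p\<^sub>c mono(1) c(1) mono(2) c(2)]) auto
  qed (use F F_mono d_F d_int in auto)
  from martingale_differences_scale[OF this, of "\<lambda>_. 2"]
  have mart: "martingale_differences P F (\<lambda>t \<omega>. 2 * d t \<omega>)" .
  have "AE \<omega> in P. (\<lambda>t. U t \<omega>) \<longlonglongrightarrow> 0"
  proof (rule lyapunov_AE_tendsto_zero[OF mart rec U_nn U_int])
    show "0 \<le> 2 * D t \<omega>" for t \<omega>
      using drift_nonneg[where \<phi>\<^sub>o="?\<phi>\<^sub>o" and \<phi>\<^sub>c="?\<phi>\<^sub>c", OF graph(1) less_imp_le[OF \<beta>] odd_\<phi> mono_\<phi>]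
      by (simp add: D_def f_def)
    show "0 \<le> r t \<omega>" for t \<omega> unfolding r_def by (simp add: sum_nonneg)
    show "r t \<omega> \<le> real N * B\<^sup>2" for t \<omega>
      using sum_bounded_above[of ?V "\<lambda>i. (norm (g t \<omega> i))\<^sup>2" "B\<^sup>2"] g_le
      unfolding r_def by (simp add: power_mono)
    show "expectation (\<lambda>\<omega>. (2 * d t \<omega>)\<^sup>2) \<le> 16 * B\<^sup>2 * real N * expectation (U t)" for t
    proof -
      have "expectation (\<lambda>\<omega>. (2 * d t \<omega>)\<^sup>2) \<le> expectation (\<lambda>\<omega>. 16 * B\<^sup>2 * real N * U t \<omega>)"
        using d_le d_int U_int by (intro integral_mono) (auto simp: power_mult_distrib mult_ac)
      then show ?thesis by simp
    qed
    show "\<not> summable \<alpha>" "summable (\<lambda>t. (\<alpha> t)\<^sup>2)" using step_sizes[OF params(1,3,4) step] by auto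
    show "\<exists>\<eta>>0. \<forall>t \<omega>. \<epsilon> \<le> U t \<omega> \<longrightarrow> \<eta> \<le> 2 * D t \<omega>" if \<epsilon>: "0 < \<epsilon>" for \<epsilon>
    proof -
      obtain \<eta> where \<eta>: "0 < \<eta>" "\<And>e. \<epsilon> \<le> (\<Sum>i\<in>?V. (norm (e i))\<^sup>2) \<Longrightarrow>
          \<eta> \<le> (\<Sum>i\<in>?V. e i \<bullet> direction E h ?\<beta> ?\<phi>\<^sub>o ?\<phi>\<^sub>c e (\<lambda>_. 0) (\<lambda>_. 0) i)"
        using drift_bounded_below[where \<phi>\<^sub>o="?\<phi>\<^sub>o" and \<phi>\<^sub>c="?\<phi>\<^sub>c", OF graph observable \<beta> odd_\<phi> mono_\<phi>
            mean_response_pos[OF p\<^sub>o \<Psi>(1)] mean_response_pos[OF p\<^sub>c \<Psi>(2)] \<epsilon>] by blast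
      then show ?thesis
        by (intro exI[of _ "2 * \<eta>"]) (auto simp: U_def D_def f_def)
    qed
  qed (use \<alpha>_pos in auto)
  then have conv: "AE \<omega> in P. (\<lambda>t. x i t \<omega>) \<longlonglongrightarrow> \<theta>" if "i \<in> ?V" for i
  proof eventually_elim
    fix \<omega> assume U: "(\<lambda>t. U t \<omega>) \<longlonglongrightarrow> 0"
    have "(\<lambda>t. (norm (e t \<omega> i))\<^sup>2) \<longlonglongrightarrow> 0"
    proof (rule tendsto_sandwich[OF _ _ tendsto_const U])
      have "(norm (e t \<omega> i))\<^sup>2 \<le> U t \<omega>" for t
        unfolding U_def by (rule member_le_sum[OF that]) auto
      then show "\<forall>\<^sub>F t in sequentially. (norm (e t \<omega> i))\<^sup>2 \<le> U t \<omega>" by simp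
    qed simp
    then have "(\<lambda>t. norm (e t \<omega> i)) \<longlonglongrightarrow> 0"
      using tendsto_real_sqrt by fastforce
    then show "(\<lambda>t. x i t \<omega>) \<longlonglongrightarrow> \<theta>"
      by (simp add: e_def tendsto_norm_zero_iff LIM_zero_iff)
  qed
  then show ?thesis by blast
qed

end
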